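(* Let $(X,S)$ be a templicial object in $\mathcal{V}$ and assume it has non-degenerate simplices. For any integer $n\ge0$, there is an isomorphism of $\mathcal{V}$-enriched quivers $$X_n\simeq\coprod_{\sigma:[n]\twoheadrightarrow[k]\text{ in }\mathbf{\Delta}_{surj}}X^{nd}_k,$$ where the coproduct runs over all $k\ge 0$ and all surjective order-preserving maps $\sigma:[n]\twoheadrightarrow[k]$.
   Context: Fix a complete and cocomplete, symmetric monoidal closed category $(\mathcal{V},\otimes,I)$. For a set $S$, $\mathcal{V}\mathrm{Quiv}_S$ is the category of families $Q=(Q(a,b))_{a,b\in S}$ of objects of $\mathcal{V}$ (called $\mathcal{V}$-enriched quivers), with families of morphisms as morphisms. It is monoidal with $(Q\otimes_S P)(a,b)=\coprod_{c\in S}Q(a,c)\otimes P(c,b)$ and unit $I_S$, where $I_S(a,b)=I$ if $a=b$ and $0$ (initial object) otherwise. $\mathbf{\Delta}_f$ is the category with objects $[n]=\{0,\dots,n\}$, $n\ge0$, and order-preserving maps preserving first and last elements, monoidal via $[m]+[n]=[m+n]$ (identifying top endpoint of $[m]$ with bottom endpoint of $[n]$) with unit $[0]$. $\mathbf{\Delta}_{surj}\subseteq\mathbf{\Delta}_f$ is the subcategory of surjective order-preserving maps. A templicial object in $\mathcal{V}$ is a pair $(X,S)$ with $S$ a set and $X:\mathbf{\Delta}_f^{op}\to\mathcal{V}\mathrm{Quiv}_S$ a colax monoidal functor whose counit $X_0\to I_S$ is an isomorphism; $X_n=X([n])$. For a functor $X:\mathbf{\Delta}_{surj}^{op}\to\mathcal{W}$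 with $\mathcal{W}$ cocomplete, and $n\ge0$, put $$X^{deg}_n=\mathrm{colim}_{\sigma:[n]\twoheadrightarrow[k],\ 0\le k<n}X_k,$$ the colimit of the functor $\sigma\mapsto X_k$ on the opposite of the category whose objects are surjections $\sigma:[n]\twoheadrightarrow[k]$ in $\mathbf{\Delta}_{surj}$ with $k<n$ and whose morphisms from $\sigma:[n]\twoheadrightarrow[k]$ to $\sigma':[n]\twoheadrightarrow[k']$ are surjections $\tau:[k]\twoheadrightarrow[k']$ with $\tau\sigma=\sigma'$. The maps $X(\sigma)$ induce a canonical morphism $X^{deg}_n\to X_n$. A templicial object $(X,S)$ has non-degenerate simplices if for every $n\ge0$ the morphism $X^{deg}_n\to X_n$ (for the restriction of $X$ to $\mathbf{\Delta}_{surj}^{op}$) is isomorphic to a coprojection $X^{deg}_n\to X^{deg}_n\amalg N$ for some $N\in\mathcal{V}\mathrm{Quiv}_S$; one fixes a choice of such $N$ for each $n$ and denotes it $X^{nd}_n$. *)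

theory Defs
  imports "HOL-Library.FuncSet"
begin

section \<open>Categories, functors, colimits\<close>

record ('o, 'a) cat =
  Obj :: "'o set"
  Arr :: "'a set"
  Dom :: "'a \<Rightarrow> 'o"
  Cod :: "'a \<Rightarrow> 'o"
  Ident :: "'o \<Rightarrow> 'a"
  Comp :: "'a \<Rightarrow> 'a \<Rightarrow> 'a" (infixl "\<cdot>\<index>" 70)

definition hom :: "('o, 'a, 'x) cat_scheme \<Rightarrow> 'o \<Rightarrow> 'o \<Rightarrow> 'a set" where
  "hom C a b = {f \<in> Arr C. Dom C f = a \<and> Cod C f = b}"

locale category =
  fixes C :: "('o, 'a, 'x) cat_scheme" (structure)
  assumes Dom_in: "f \<in> Arr C \<Longrightarrow> Dom C f \<in> Obj C"
    and Cod_in: "f \<in> Arr C \<Longrightarrow> Cod C f \<in> Obj C"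
    and Ident_hom: "a \<in> Obj C \<Longrightarrow> Ident C a \<in> hom C a a"
    and Comp_hom: "f \<in> hom C a b \<Longrightarrow> g \<in> hom C b c \<Longrightarrow> g \<cdot> f \<in> hom C a c"
    and Comp_Ident: "f \<in> hom C a b \<Longrightarrow> f \<cdot> Ident C a = f"
    and Ident_Comp: "f \<in> hom C a b \<Longrightarrow> Ident C b \<cdot> f = f"
    and Comp_assoc: "f \<in> hom C a b \<Longrightarrow> g \<in> hom C b c \<Longrightarrow> h \<in> hom C c d
      \<Longrightarrow> h \<cdot> g \<cdot> f = h \<cdot> (g \<cdot> f)"

definition is_inverse :: "('o, 'a, 'x) cat_scheme \<Rightarrow> 'a \<Rightarrow> 'a \<Rightarrow> bool" where
  "is_inverse C f g \<longleftrightarrow> g \<in> hom C (Cod C f) (Dom C f) \<and>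
     g \<cdot>\<^bsub>C\<^esub> f = Ident C (Dom C f) \<and> f \<cdot>\<^bsub>C\<^esub> g = Ident C (Cod C f)"

definition is_iso :: "('o, 'a, 'x) cat_scheme \<Rightarrow> 'a \<Rightarrow> bool" where
  "is_iso C f \<longleftrightarrow> f \<in> Arr C \<and> (\<exists>g. is_inverse C f g)"

definition inv_arr :: "('o, 'a, 'x) cat_scheme \<Rightarrow> 'a \<Rightarrow> 'a" where
  "inv_arr C f = (THE g. is_inverse C f g)"

definition isomorphic :: "('o, 'a, 'x) cat_scheme \<Rightarrow> 'o \<Rightarrow> 'o \<Rightarrow> bool" where
  "isomorphic C a b \<longleftrightarrow> (\<exists>f \<in> hom C a b. is_iso C f)"

text \<open>Isomorphism in the category of arrows and commutative squares of \<open>C\<close>.\<close>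

definition isomorphic_arrows :: "('o, 'a, 'x) cat_scheme \<Rightarrow> 'a \<Rightarrow> 'a \<Rightarrow> bool" where
  "isomorphic_arrows C f g \<longleftrightarrow>
     (\<exists>u \<in> hom C (Dom C f) (Dom C g). \<exists>v \<in> hom C (Cod C f) (Cod C g).
        is_iso C u \<and> is_iso C v \<and> v \<cdot>\<^bsub>C\<^esub> f = g \<cdot>\<^bsub>C\<^esub> u)"

definition opcat :: "('o, 'a, 'x) cat_scheme \<Rightarrow> ('o, 'a, 'x) cat_scheme" where
  "opcat C = C\<lparr>Dom := Cod C, Cod := Dom C, Comp := (\<lambda>g f. f \<cdot>\<^bsub>C\<^esub> g)\<rparr>"

record ('o, 'a, 'p, 'b) functor_data =
  FObj :: "'o \<Rightarrow> 'p"
  FArr :: "'a \<Rightarrow> 'b"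

locale cat_functor =
  fixes C :: "('o, 'a, 'x) cat_scheme"
    and D :: "('p, 'b, 'y) cat_scheme"
    and F :: "('o, 'a, 'p, 'b, 'z) functor_data_scheme"
  assumes FObj_in: "a \<in> Obj C \<Longrightarrow> FObj F a \<in> Obj D"
    and FArr_hom: "f \<in> hom C a b \<Longrightarrow> FArr F f \<in> hom D (FObj F a) (FObj F b)"
    and FArr_Ident: "a \<in> Obj C \<Longrightarrow> FArr F (Ident C a) = Ident D (FObj F a)"
    and FArr_Comp: "f \<in> hom C a b \<Longrightarrow> g \<in> hom C b c
      \<Longrightarrow> FArr F (g \<cdot>\<^bsub>C\<^esub> f) = FArr F g \<cdot>\<^bsub>D\<^esub> FArr F f"

definition is_cocone :: "('o, 'a, 'x) cat_scheme \<Rightarrow> ('j, 'k, 'y) cat_scheme \<Rightarrow>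
    ('j, 'k, 'o, 'a, 'z) functor_data_scheme \<Rightarrow> 'o \<Rightarrow> ('j \<Rightarrow> 'a) \<Rightarrow> bool" where
  "is_cocone C J F T g \<longleftrightarrow> T \<in> Obj C \<and> (\<forall>j \<in> Obj J. g j \<in> hom C (FObj F j) T) \<and>
     (\<forall>u \<in> Arr J. g (Cod J u) \<cdot>\<^bsub>C\<^esub> FArr F u = g (Dom J u))"

definition is_colimit :: "('o, 'a, 'x) cat_scheme \<Rightarrow> ('j, 'k, 'y) cat_scheme \<Rightarrow>
    ('j, 'k, 'o, 'a, 'z) functor_data_scheme \<Rightarrow> 'o \<Rightarrow> ('j \<Rightarrow> 'a) \<Rightarrow> bool" where
  "is_colimit C J F L i \<longleftrightarrow> is_cocone C J F L i \<and>
     (\<forall>T g. is_cocone C J F T g \<longrightarrow>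
        (\<exists>!h. h \<in> hom C L T \<and> (\<forall>j \<in> Obj J. h \<cdot>\<^bsub>C\<^esub> i j = g j)))"

definition is_limit :: "('o, 'a, 'x) cat_scheme \<Rightarrow> ('j, 'k, 'y) cat_scheme \<Rightarrow>
    ('j, 'k, 'o, 'a, 'z) functor_data_scheme \<Rightarrow> 'o \<Rightarrow> ('j \<Rightarrow> 'a) \<Rightarrow> bool" where
  "is_limit C J F L p \<longleftrightarrow> is_colimit (opcat C) (opcat J) F L p"

text \<open>
  (Co)completeness is relative to a type \<open>'i\<close> of small elements: the small sets are the sets
  over \<open>'i\<close>, and a small category has its objects and its arrows in \<open>'i\<close>. The
  objects and arrows of \<open>C\<close> itself live in types that are unrelated to \<open>'i\<close>.
  Every finite category is small, up to isomorphism, only if \<open>'i\<close> is infinite.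
\<close>

definition complete_cat :: "'i itself \<Rightarrow> ('o, 'a, 'x) cat_scheme \<Rightarrow> bool" where
  "complete_cat _ C \<longleftrightarrow> (\<forall>(J :: ('i, 'i) cat) (F :: ('i, 'i, 'o, 'a) functor_data).
     category J \<and> cat_functor J C F \<longrightarrow> (\<exists>L p. is_limit C J F L p))"

definition cocomplete_cat :: "'i itself \<Rightarrow> ('o, 'a, 'x) cat_scheme \<Rightarrow> bool" where
  "cocomplete_cat _ C \<longleftrightarrow> (\<forall>(J :: ('i, 'i) cat) (F :: ('i, 'i, 'o, 'a) functor_data).
     category J \<and> cat_functor J C F \<longrightarrow> (\<exists>L i. is_colimit C J F L i))"

text \<open>Chosen colimits; they are meaningful only if the colimit in question exists.\<close>

definition colimit :: "('o, 'a, 'x) cat_scheme \<Rightarrow> ('j, 'k, 'y) cat_scheme \<Rightarrow>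
    ('j, 'k, 'o, 'a, 'z) functor_data_scheme \<Rightarrow> 'o \<times> ('j \<Rightarrow> 'a)" where
  "colimit C J F = (SOME (L, i). is_colimit C J F L i)"

definition is_coproduct :: "('o, 'a, 'x) cat_scheme \<Rightarrow> 'j set \<Rightarrow> ('j \<Rightarrow> 'o) \<Rightarrow> 'o \<Rightarrow> ('j \<Rightarrow> 'a) \<Rightarrow> bool"
  where
  "is_coproduct C A F P i \<longleftrightarrow> P \<in> Obj C \<and> (\<forall>j \<in> A. i j \<in> hom C (F j) P) \<and>
     (\<forall>T g. T \<in> Obj C \<and> (\<forall>j \<in> A. g j \<in> hom C (F j) T) \<longrightarrow>
        (\<exists>!h. h \<in> hom C P T \<and> (\<forall>j \<in> A. h \<cdot>\<^bsub>C\<^esub> i j = g j)))"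

definition coproduct :: "('o, 'a, 'x) cat_scheme \<Rightarrow> 'j set \<Rightarrow> ('j \<Rightarrow> 'o) \<Rightarrow> 'o \<times> ('j \<Rightarrow> 'a)" where
  "coproduct C A F = (SOME (P, i). is_coproduct C A F P i)"

definition Coprod :: "('o, 'a, 'x) cat_scheme \<Rightarrow> 'j set \<Rightarrow> ('j \<Rightarrow> 'o) \<Rightarrow> 'o" where
  "Coprod C A F = fst (coproduct C A F)"

definition coproj :: "('o, 'a, 'x) cat_scheme \<Rightarrow> 'j set \<Rightarrow> ('j \<Rightarrow> 'o) \<Rightarrow> 'j \<Rightarrow> 'a" where
  "coproj C A F = snd (coproduct C A F)"

definition left_coproj :: "('o, 'a, 'x) cat_scheme \<Rightarrow> 'o \<Rightarrow> 'o \<Rightarrow> 'a" where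
  "left_coproj C a b = coproj C UNIV (case_bool a b) True"

definition initial_obj :: "('o, 'a, 'x) cat_scheme \<Rightarrow> 'o" where
  "initial_obj C = (SOME z. z \<in> Obj C \<and> (\<forall>a \<in> Obj C. \<exists>!f. f \<in> hom C z a))"


section \<open>Monoidal categories and colax monoidal functors\<close>

record ('o, 'a) monoidal_cat = "('o, 'a) cat" +
  TObj :: "'o \<Rightarrow> 'o \<Rightarrow> 'o" (infixl "\<otimes>\<index>" 75)
  TArr :: "'a \<Rightarrow> 'a \<Rightarrow> 'a" (infixl "\<boxtimes>\<index>" 75)
  Unit :: 'o
  assoc :: "'o \<Rightarrow> 'o \<Rightarrow> 'o \<Rightarrow> 'a"
  lunit :: "'o \<Rightarrow> 'a"
  runit :: "'o \<Rightarrow> 'a"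

locale monoidal_category = category C
  for C :: "('o, 'a, 'x) monoidal_cat_scheme" (structure) +
  assumes TObj_in: "a \<in> Obj C \<Longrightarrow> b \<in> Obj C \<Longrightarrow> a \<otimes> b \<in> Obj C"
    and TArr_hom: "f \<in> hom C a a' \<Longrightarrow> g \<in> hom C b b' \<Longrightarrow> f \<boxtimes> g \<in> hom C (a \<otimes> b) (a' \<otimes> b')"
    and TArr_Ident: "a \<in> Obj C \<Longrightarrow> b \<in> Obj C \<Longrightarrow> Ident C a \<boxtimes> Ident C b = Ident C (a \<otimes> b)"
    and TArr_Comp: "f \<in> hom C a a' \<Longrightarrow> f' \<in> hom C a' a'' \<Longrightarrow> g \<in> hom C b b' \<Longrightarrow> g' \<in> hom C b' b''
      \<Longrightarrow> (f' \<cdot> f) \<boxtimes> (g' \<cdot> g) = (f' \<boxtimes> g') \<cdot> (f \<boxtimes> g)"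
    and Unit_in: "Unit C \<in> Obj C"
    and assoc_hom: "a \<in> Obj C \<Longrightarrow> b \<in> Obj C \<Longrightarrow> c \<in> Obj C
      \<Longrightarrow> assoc C a b c \<in> hom C (a \<otimes> b \<otimes> c) (a \<otimes> (b \<otimes> c))"
    and assoc_iso: "a \<in> Obj C \<Longrightarrow> b \<in> Obj C \<Longrightarrow> c \<in> Obj C \<Longrightarrow> is_iso C (assoc C a b c)"
    and assoc_natural: "f \<in> hom C a a' \<Longrightarrow> g \<in> hom C b b' \<Longrightarrow> h \<in> hom C c c'
      \<Longrightarrow> assoc C a' b' c' \<cdot> (f \<boxtimes> g \<boxtimes> h) = (f \<boxtimes> (g \<boxtimes> h)) \<cdot> assoc C a b c"
    and lunit_hom: "a \<in> Obj C \<Longrightarrow> lunit C a \<in> hom C (Unit C \<otimes> a) a"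
    and lunit_iso: "a \<in> Obj C \<Longrightarrow> is_iso C (lunit C a)"
    and lunit_natural: "f \<in> hom C a a' \<Longrightarrow> lunit C a' \<cdot> (Ident C (Unit C) \<boxtimes> f) = f \<cdot> lunit C a"
    and runit_hom: "a \<in> Obj C \<Longrightarrow> runit C a \<in> hom C (a \<otimes> Unit C) a"
    and runit_iso: "a \<in> Obj C \<Longrightarrow> is_iso C (runit C a)"
    and runit_natural: "f \<in> hom C a a' \<Longrightarrow> runit C a' \<cdot> (f \<boxtimes> Ident C (Unit C)) = f \<cdot> runit C a"
    and pentagon: "a \<in> Obj C \<Longrightarrow> b \<in> Obj C \<Longrightarrow> c \<in> Obj C \<Longrightarrow> d \<in> Obj C
      \<Longrightarrow> assoc C a b (c \<otimes> d) \<cdot> assoc C (a \<otimes> b) c d =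
          (Ident C a \<boxtimes> assoc C b c d) \<cdot> assoc C a (b \<otimes> c) d \<cdot> (assoc C a b c \<boxtimes> Ident C d)"
    and triangle: "a \<in> Obj C \<Longrightarrow> b \<in> Obj C
      \<Longrightarrow> (Ident C a \<boxtimes> lunit C b) \<cdot> assoc C a (Unit C) b = runit C a \<boxtimes> Ident C b"

record ('o, 'a) symmetric_monoidal_cat = "('o, 'a) monoidal_cat" +
  braid :: "'o \<Rightarrow> 'o \<Rightarrow> 'a"

locale symmetric_monoidal_category = monoidal_category C
  for C :: "('o, 'a, 'x) symmetric_monoidal_cat_scheme" (structure) +
  assumes braid_hom: "a \<in> Obj C \<Longrightarrow> b \<in> Obj C \<Longrightarrow> braid C a b \<in> hom C (a \<otimes> b) (b \<otimes> a)"
    and braid_natural: "f \<in> hom C a a' \<Longrightarrow> g \<in> hom C b b'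
      \<Longrightarrow> braid C a' b' \<cdot> (f \<boxtimes> g) = (g \<boxtimes> f) \<cdot> braid C a b"
    and braid_braid: "a \<in> Obj C \<Longrightarrow> b \<in> Obj C \<Longrightarrow> braid C b a \<cdot> braid C a b = Ident C (a \<otimes> b)"
    and hexagon: "a \<in> Obj C \<Longrightarrow> b \<in> Obj C \<Longrightarrow> c \<in> Obj C
      \<Longrightarrow> assoc C b c a \<cdot> braid C a (b \<otimes> c) \<cdot> assoc C a b c =
          (Ident C b \<boxtimes> braid C a c) \<cdot> assoc C b a c \<cdot> (braid C a b \<boxtimes> Ident C c)"

text \<open>
  Closedness says that each functor \<open>- \<otimes> b\<close> has a right adjoint, given by universal arrows
  \<open>e : h \<otimes> b \<rightarrow> c\<close> with \<open>h\<close> the internal hom of \<open>b\<close> and \<open>c\<close>.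
\<close>

locale symmetric_monoidal_closed_category = symmetric_monoidal_category C
  for C :: "('o, 'a, 'x) symmetric_monoidal_cat_scheme" (structure) +
  assumes closed: "b \<in> Obj C \<Longrightarrow> c \<in> Obj C \<Longrightarrow>
      \<exists>h \<in> Obj C. \<exists>e \<in> hom C (h \<otimes> b) c. \<forall>a \<in> Obj C. \<forall>f \<in> hom C (a \<otimes> b) c.
        \<exists>!g. g \<in> hom C a h \<and> e \<cdot> (g \<boxtimes> Ident C b) = f"

definition op_monoidal :: "('o, 'a, 'x) monoidal_cat_scheme \<Rightarrow> ('o, 'a, 'x) monoidal_cat_scheme" where
  "op_monoidal C = (opcat C)
     \<lparr>assoc := (\<lambda>a b c. inv_arr C (assoc C a b c)),
      lunit := (\<lambda>a. inv_arr C (lunit C a)),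
      runit := (\<lambda>a. inv_arr C (runit C a))\<rparr>"

record ('o, 'a, 'p, 'b) colax_data = "('o, 'a, 'p, 'b) functor_data" +
  comult :: "'o \<Rightarrow> 'o \<Rightarrow> 'b"
  counit :: 'b

locale colax_monoidal_functor = cat_functor C D F
  for C :: "('o, 'a, 'x) monoidal_cat_scheme"
    and D :: "('p, 'b, 'y) monoidal_cat_scheme"
    and F :: "('o, 'a, 'p, 'b, 'z) colax_data_scheme" +
  assumes comult_hom: "a \<in> Obj C \<Longrightarrow> b \<in> Obj C
      \<Longrightarrow> comult F a b \<in> hom D (FObj F (a \<otimes>\<^bsub>C\<^esub> b)) (FObj F a \<otimes>\<^bsub>D\<^esub> FObj F b)"
    and comult_natural: "f \<in> hom C a a' \<Longrightarrow> g \<in> hom C b b'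
      \<Longrightarrow> comult F a' b' \<cdot>\<^bsub>D\<^esub> FArr F (f \<boxtimes>\<^bsub>C\<^esub> g) = (FArr F f \<boxtimes>\<^bsub>D\<^esub> FArr F g) \<cdot>\<^bsub>D\<^esub> comult F a b"
    and counit_hom: "counit F \<in> hom D (FObj F (Unit C)) (Unit D)"
    and coassociative: "a \<in> Obj C \<Longrightarrow> b \<in> Obj C \<Longrightarrow> c \<in> Obj C
      \<Longrightarrow> assoc D (FObj F a) (FObj F b) (FObj F c) \<cdot>\<^bsub>D\<^esub>
            (comult F a b \<boxtimes>\<^bsub>D\<^esub> Ident D (FObj F c)) \<cdot>\<^bsub>D\<^esub> comult F (a \<otimes>\<^bsub>C\<^esub> b) c =
          (Ident D (FObj F a) \<boxtimes>\<^bsub>D\<^esub> comult F b c) \<cdot>\<^bsub>D\<^esub>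
            comult F a (b \<otimes>\<^bsub>C\<^esub> c) \<cdot>\<^bsub>D\<^esub> FArr F (assoc C a b c)"
    and left_counital: "a \<in> Obj C
      \<Longrightarrow> lunit D (FObj F a) \<cdot>\<^bsub>D\<^esub> (counit F \<boxtimes>\<^bsub>D\<^esub> Ident D (FObj F a)) \<cdot>\<^bsub>D\<^esub> comult F (Unit C) a
          = FArr F (lunit C a)"
    and right_counital: "a \<in> Obj C
      \<Longrightarrow> runit D (FObj F a) \<cdot>\<^bsub>D\<^esub> (Ident D (FObj F a) \<boxtimes>\<^bsub>D\<^esub> counit F) \<cdot>\<^bsub>D\<^esub> comult F a (Unit C)
          = FArr F (runit C a)"


section \<open>Enriched quivers\<close>

text \<open>
  Quivers, and their morphisms, are extensional functions on \<open>S \<times> S\<close>. A family of morphisms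
  determines its domain and codomain quivers componentwise.

  The structure morphisms are determined by their restrictions along coprojections: \<open>\<otimes>\<close> on
  \<open>\<V>\<close> preserves coproducts in each variable, so the terms \<open>(Q(a,d) \<otimes> P(d,c)) \<otimes> R(c,b)\<close>
  are jointly the summands of the domain of the associator, and for \<open>c \<noteq> a\<close> the summand
  \<open>I\<^sub>S(a,c) \<otimes> Q(c,b)\<close> of the domain of the left unitor is initial (dually for the right unitor).
\<close>

definition qtens :: "('o, 'a, 'x) monoidal_cat_scheme \<Rightarrow> 'i set \<Rightarrow>
    ('i \<times> 'i \<Rightarrow> 'o) \<Rightarrow> ('i \<times> 'i \<Rightarrow> 'o) \<Rightarrow> 'i \<times> 'i \<Rightarrow> 'o" where
  "qtens V S Q P = (\<lambda>(a, b) \<in> S \<times> S. Coprod V S (\<lambda>c. Q (a, c) \<otimes>\<^bsub>V\<^esub> P (c, b)))"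

definition qin :: "('o, 'a, 'x) monoidal_cat_scheme \<Rightarrow> 'i set \<Rightarrow>
    ('i \<times> 'i \<Rightarrow> 'o) \<Rightarrow> ('i \<times> 'i \<Rightarrow> 'o) \<Rightarrow> 'i \<Rightarrow> 'i \<Rightarrow> 'i \<Rightarrow> 'a" where
  "qin V S Q P a b c = coproj V S (\<lambda>c. Q (a, c) \<otimes>\<^bsub>V\<^esub> P (c, b)) c"

definition qunit :: "('o, 'a, 'x) monoidal_cat_scheme \<Rightarrow> 'i set \<Rightarrow> 'i \<times> 'i \<Rightarrow> 'o" where
  "qunit V S = (\<lambda>(a, b) \<in> S \<times> S. if a = b then Unit V else initial_obj V)"

definition quiv_cat :: "('o, 'a, 'x) cat_scheme \<Rightarrow> 'i set \<Rightarrow> ('i \<times> 'i \<Rightarrow> 'o, 'i \<times> 'i \<Rightarrow> 'a) cat" where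
  "quiv_cat V S =
    \<lparr>Obj = S \<times> S \<rightarrow>\<^sub>E Obj V,
     Arr = S \<times> S \<rightarrow>\<^sub>E Arr V,
     Dom = (\<lambda>f. \<lambda>p \<in> S \<times> S. Dom V (f p)),
     Cod = (\<lambda>f. \<lambda>p \<in> S \<times> S. Cod V (f p)),
     Ident = (\<lambda>Q. \<lambda>p \<in> S \<times> S. Ident V (Q p)),
     Comp = (\<lambda>g f. \<lambda>p \<in> S \<times> S. g p \<cdot>\<^bsub>V\<^esub> f p)\<rparr>"

definition Quiv :: "('o, 'a, 'x) monoidal_cat_scheme \<Rightarrow> 'i set \<Rightarrow>
    ('i \<times> 'i \<Rightarrow> 'o, 'i \<times> 'i \<Rightarrow> 'a) monoidal_cat" where
  "Quiv V S = cat.extend (quiv_cat V S) (monoidal_cat.fields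
     (qtens V S)
     (\<lambda>f g. \<lambda>(a, b) \<in> S \<times> S. THE h.
        h \<in> hom V (qtens V S (Dom (quiv_cat V S) f) (Dom (quiv_cat V S) g) (a, b))
                  (qtens V S (Cod (quiv_cat V S) f) (Cod (quiv_cat V S) g) (a, b)) \<and>
        (\<forall>c \<in> S. h \<cdot>\<^bsub>V\<^esub> qin V S (Dom (quiv_cat V S) f) (Dom (quiv_cat V S) g) a b c =
           qin V S (Cod (quiv_cat V S) f) (Cod (quiv_cat V S) g) a b c \<cdot>\<^bsub>V\<^esub>
             (f (a, c) \<boxtimes>\<^bsub>V\<^esub> g (c, b))))
     (qunit V S)
     (\<lambda>Q P R. \<lambda>(a, b) \<in> S \<times> S. THE h.
        h \<in> hom V (qtens V S (qtens V S Q P) R (a, b)) (qtens V S Q (qtens V S P R) (a, b)) \<and>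
        (\<forall>c \<in> S. \<forall>d \<in> S.
           h \<cdot>\<^bsub>V\<^esub> qin V S (qtens V S Q P) R a b c \<cdot>\<^bsub>V\<^esub> (qin V S Q P a c d \<boxtimes>\<^bsub>V\<^esub> Ident V (R (c, b))) =
           qin V S Q (qtens V S P R) a b d \<cdot>\<^bsub>V\<^esub> (Ident V (Q (a, d)) \<boxtimes>\<^bsub>V\<^esub> qin V S P R d b c) \<cdot>\<^bsub>V\<^esub>
             assoc V (Q (a, d)) (P (d, c)) (R (c, b))))
     (\<lambda>Q. \<lambda>(a, b) \<in> S \<times> S. THE h.
        h \<in> hom V (qtens V S (qunit V S) Q (a, b)) (Q (a, b)) \<and>
        h \<cdot>\<^bsub>V\<^esub> qin V S (qunit V S) Q a b a = lunit V (Q (a, b)))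
     (\<lambda>Q. \<lambda>(a, b) \<in> S \<times> S. THE h.
        h \<in> hom V (qtens V S Q (qunit V S) (a, b)) (Q (a, b)) \<and>
        h \<cdot>\<^bsub>V\<^esub> qin V S Q (qunit V S) a b b = runit V (Q (a, b))))"


section \<open>The simplex categories and templicial objects\<close>

text \<open>The object \<open>[n]\<close> is \<open>n\<close>; an arrow \<open>[m] \<rightarrow> [n]\<close> is a triple \<open>(m, n, f)\<close>.\<close>

type_synonym simp_arr = "nat \<times> nat \<times> (nat \<Rightarrow> nat)"

definition Delta_f :: "(nat, simp_arr) monoidal_cat" where
  "Delta_f =
    \<lparr>Obj = UNIV,
     Arr = {(m, n, f). f \<in> {..m} \<rightarrow>\<^sub>E {..n} \<and> mono_on {..m} f \<and> f 0 = 0 \<and> f m = n},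
     Dom = (\<lambda>(m, n, f). m),
     Cod = (\<lambda>(m, n, f). n),
     Ident = (\<lambda>n. (n, n, \<lambda>i \<in> {..n}. i)),
     Comp = (\<lambda>(n, p, g) (m, n', f). (m, p, \<lambda>i \<in> {..m}. g (f i))),
     TObj = (+),
     TArr = (\<lambda>(m, m', f) (n, n', g).
       (m + n, m' + n', \<lambda>i \<in> {..m + n}. if i \<le> m then f i else m' + g (i - m))),
     Unit = 0,
     assoc = (\<lambda>m n p. (m + n + p, m + n + p, \<lambda>i \<in> {..m + n + p}. i)),
     lunit = (\<lambda>n. (n, n, \<lambda>i \<in> {..n}. i)),
     runit = (\<lambda>n. (n, n, \<lambda>i \<in> {..n}. i))\<rparr>"

definition Delta_surj :: "(nat, simp_arr) monoidal_cat" where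
  "Delta_surj = Delta_f\<lparr>Arr := {(m, n, f) \<in> Arr Delta_f. f ` {..m} = {..n}}\<rparr>"

type_synonym ('i, 'o, 'a) templicial =
  "(nat, simp_arr, 'i \<times> 'i \<Rightarrow> 'o, 'i \<times> 'i \<Rightarrow> 'a) colax_data"

definition templicial_object ::
    "('o, 'a, 'x) monoidal_cat_scheme \<Rightarrow> ('i, 'o, 'a) templicial \<Rightarrow> 'i set \<Rightarrow> bool" where
  "templicial_object V X S \<longleftrightarrow>
     colax_monoidal_functor (op_monoidal Delta_f) (Quiv V S) X \<and> is_iso (Quiv V S) (counit X)"


section \<open>Degenerate and non-degenerate simplices\<close>

definition surjections :: "nat \<Rightarrow> simp_arr set" where
  "surjections n = {\<sigma> \<in> Arr Delta_surj. Dom Delta_surj \<sigma> = n}"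

text \<open>A morphism \<open>\<tau>\<close> from \<open>\<sigma>\<close> to \<open>\<sigma>'\<close> is the triple \<open>(\<sigma>, \<tau>, \<sigma>')\<close>.\<close>

definition deg_index :: "nat \<Rightarrow> (simp_arr, simp_arr \<times> simp_arr \<times> simp_arr) cat" where
  "deg_index n =
    \<lparr>Obj = {\<sigma> \<in> surjections n. Cod Delta_surj \<sigma> < n},
     Arr = {(\<sigma>, \<tau>, \<sigma>'). \<sigma> \<in> surjections n \<and> Cod Delta_surj \<sigma> < n \<and>
       \<sigma>' \<in> surjections n \<and> Cod Delta_surj \<sigma>' < n \<and>
       \<tau> \<in> hom Delta_surj (Cod Delta_surj \<sigma>) (Cod Delta_surj \<sigma>') \<and> \<tau> \<cdot>\<^bsub>Delta_surj\<^esub> \<sigma> = \<sigma>'},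
     Dom = (\<lambda>(\<sigma>, \<tau>, \<sigma>'). \<sigma>),
     Cod = (\<lambda>(\<sigma>, \<tau>, \<sigma>'). \<sigma>'),
     Ident = (\<lambda>\<sigma>. (\<sigma>, Ident Delta_surj (Cod Delta_surj \<sigma>), \<sigma>)),
     Comp = (\<lambda>(\<sigma>', \<tau>', \<sigma>'') (\<sigma>, \<tau>, \<rho>). (\<sigma>, \<tau>' \<cdot>\<^bsub>Delta_surj\<^esub> \<tau>, \<sigma>''))\<rparr>"

text \<open>
  Below, \<open>X\<close> is a functor on the opposite of \<^const>\<open>Delta_surj\<close>. A functor on the opposite
  of \<^const>\<open>Delta_f\<close> is restricted by keeping its data.
\<close>

definition deg_diagram :: "(nat, simp_arr, 'o, 'a, 'z) functor_data_scheme \<Rightarrow>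
    (simp_arr, simp_arr \<times> simp_arr \<times> simp_arr, 'o, 'a) functor_data" where
  "deg_diagram X =
    \<lparr>FObj = (\<lambda>\<sigma>. FObj X (Cod Delta_surj \<sigma>)), FArr = (\<lambda>(\<sigma>, \<tau>, \<sigma>'). FArr X \<tau>)\<rparr>"

definition deg_obj :: "('o, 'a, 'x) cat_scheme \<Rightarrow> (nat, simp_arr, 'o, 'a, 'z) functor_data_scheme \<Rightarrow>
    nat \<Rightarrow> 'o" where
  "deg_obj W X n = fst (colimit W (opcat (deg_index n)) (deg_diagram X))"

definition deg_in :: "('o, 'a, 'x) cat_scheme \<Rightarrow> (nat, simp_arr, 'o, 'a, 'z) functor_data_scheme \<Rightarrow>
    nat \<Rightarrow> simp_arr \<Rightarrow> 'a" where
  "deg_in W X n = snd (colimit W (opcat (deg_index n)) (deg_diagram X))"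

definition deg_map :: "('o, 'a, 'x) cat_scheme \<Rightarrow> (nat, simp_arr, 'o, 'a, 'z) functor_data_scheme \<Rightarrow>
    nat \<Rightarrow> 'a" where
  "deg_map W X n = (THE h. h \<in> hom W (deg_obj W X n) (FObj X n) \<and>
     (\<forall>\<sigma> \<in> Obj (deg_index n). h \<cdot>\<^bsub>W\<^esub> deg_in W X n \<sigma> = FArr X \<sigma>))"

definition is_nondeg_part :: "('o, 'a, 'x) cat_scheme \<Rightarrow>
    (nat, simp_arr, 'o, 'a, 'z) functor_data_scheme \<Rightarrow> nat \<Rightarrow> 'o \<Rightarrow> bool" where
  "is_nondeg_part W X n N \<longleftrightarrow>
     N \<in> Obj W \<and> isomorphic_arrows W (deg_map W X n) (left_coproj W (deg_obj W X n) N)"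

definition has_nondeg_simplices :: "('o, 'a, 'x) monoidal_cat_scheme \<Rightarrow>
    ('i, 'o, 'a) templicial \<Rightarrow> 'i set \<Rightarrow> bool" where
  "has_nondeg_simplices V X S \<longleftrightarrow> (\<forall>n. \<exists>N. is_nondeg_part (Quiv V S) X n N)"

end

theory Submission
  imports Defs
begin

text \<open>
  Write \<open>j\<^sub>k : N\<^sub>k \<rightarrow> X\<^sub>k\<close> for the inclusion of the non-degenerate part. By strong
  induction on \<open>n\<close>, the maps \<open>X(\<sigma>) j\<^sub>k\<close> exhibit \<open>X\<^sub>n\<close> as the coproduct of the \<open>N\<^sub>k\<close>. As
  \<open>X\<^sub>n\<close> is the coproduct of its degenerate part and \<open>N\<^sub>n\<close>, which accounts for \<open>\<sigma> = id\<close>, it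
  remains to decompose the degenerate part. Given maps \<open>g\<^sub>\<sigma> : N\<^sub>k \<rightarrow> T\<close> for all proper
  surjections \<open>\<sigma>\<close>, the induction hypothesis yields a unique \<open>h\<^sub>\<sigma> : X\<^sub>k \<rightarrow> T\<close> which on the summand
  \<open>\<tau>\<close> of \<open>X\<^sub>k\<close> is the member of \<open>g\<close> at \<open>\<tau>\<sigma>\<close>. These form a cocone on the diagram whose
  colimit is the degenerate part. Only functoriality is used, not the Eilenberg--Zilber lemma.
\<close>

section \<open>Categories and coproducts\<close>

lemma homD:
  assumes "f \<in> hom C a b"
  shows "f \<in> Arr C" "Dom C f = a" "Cod C f = b"
  using assms by (auto simp: hom_def)

lemma hom_opcat [simp]: "hom (opcat C) a b = hom C b a"
  by (auto simp: hom_def opcat_def)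

lemma opcat_simps [simp]:
  "Obj (opcat C) = Obj C" "Arr (opcat C) = Arr C" "Dom (opcat C) = Cod C" "Cod (opcat C) = Dom C"
  "Ident (opcat C) = Ident C" "Comp (opcat C) g f = Comp C f g"
  by (simp_all add: opcat_def)

lemma category_opcat:
  assumes "category C"
  shows "category (opcat C)"
proof -
  interpret category C by fact
  show ?thesis
    by (unfold_locales, unfold hom_opcat opcat_simps)
      (rule Cod_in Dom_in Ident_hom Comp_hom Ident_Comp Comp_Ident Comp_assoc[symmetric]; assumption)+
qed

section \<open>Universal properties of coproducts and colimits\<close>

lemma is_coproductD:
  assumes "is_coproduct C A F P i"
  shows "P \<in> Obj C" "x \<in> A \<Longrightarrow> i x \<in> hom C (F x) P"
  using assms by (auto simp: is_coproduct_def)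

lemma is_coproduct_copair:
  assumes "is_coproduct C A F P i" "T \<in> Obj C" "\<And>x. x \<in> A \<Longrightarrow> g x \<in> hom C (F x) T"
  obtains h where "h \<in> hom C P T" "\<And>x. x \<in> A \<Longrightarrow> h \<cdot>\<^bsub>C\<^esub> i x = g x"
  using assms unfolding is_coproduct_def by blast

lemma is_colimitD:
  assumes "is_colimit C J F L i"
  shows "L \<in> Obj C" "x \<in> Obj J \<Longrightarrow> i x \<in> hom C (FObj F x) L"
    "u \<in> Arr J \<Longrightarrow> i (Cod J u) \<cdot>\<^bsub>C\<^esub> FArr F u = i (Dom J u)"
  using assms by (auto simp: is_colimit_def is_cocone_def)

text \<open>\<open>Coprod\<close> and \<open>coproj\<close> come from Hilbert choice, so they carry
  information only once some coproduct is known to exist. Any witness then passes the universal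
  property on to the chosen pair.\<close>

lemma is_coproduct_Coprod:
  assumes "is_coproduct C A F P i"
  shows "is_coproduct C A F (Coprod C A F) (coproj C A F)"
proof -
  have "case coproduct C A F of (P, i) \<Rightarrow> is_coproduct C A F P i"
    unfolding coproduct_def by (rule someI[of _ "(P, i)"]) (simp add: assms)
  then show ?thesis by (simp add: Coprod_def coproj_def case_prod_beta)
qed

lemma is_colimit_chosen:
  assumes "is_colimit C J F L i"
  shows "is_colimit C J F (fst (colimit C J F)) (snd (colimit C J F))"
proof -
  have "case colimit C J F of (P, i) \<Rightarrow> is_colimit C J F P i"
    unfolding colimit_def by (rule someI[of _ "(L, i)"]) (simp add: assms)
  then show ?thesis by (simp add: case_prod_beta)
qed

context category
begin

lemma hom_Obj:
  assumes "f \<in> hom C a b"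
  shows "a \<in> Obj C" "b \<in> Obj C"
  using assms Dom_in Cod_in by (auto simp: hom_def)

text \<open>Coprojections are jointly epic: both arrows solve the mapping problem for the family
  \<open>h' \<cdot> i x\<close>, and that solution is unique.\<close>

lemma is_coproduct_eqI:
  assumes "is_coproduct C A F P i" "h \<in> hom C P T" "h' \<in> hom C P T"
    "\<And>x. x \<in> A \<Longrightarrow> h \<cdot> i x = h' \<cdot> i x"
  shows "h = h'"
proof -
  have "\<exists>!k. k \<in> hom C P T \<and> (\<forall>x\<in>A. k \<cdot> i x = h' \<cdot> i x)"
    using assms(1) hom_Obj(2)[OF assms(2)] Comp_hom[OF is_coproductD(2)[OF assms(1)] assms(3)]
    by (simp add: is_coproduct_def)
  then show ?thesis using assms(2-4) by blast
qed

text \<open>Joint epicness again, but here the family \<open>h' \<cdot> i x\<close> must first be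
  shown to be a cocone. This is associativity, for which functoriality of \<open>F\<close> supplies
  the endpoints of the transition maps.\<close>

lemma is_colimit_eqI:
  assumes L: "is_colimit C J F L i" and J: "category J" and F: "cat_functor J C F"
    and h: "h \<in> hom C L T" and h': "h' \<in> hom C L T"
    and eq: "\<And>x. x \<in> Obj J \<Longrightarrow> h \<cdot> i x = h' \<cdot> i x"
  shows "h = h'"
proof -
  have "h' \<cdot> i (Cod J u) \<cdot> FArr F u = h' \<cdot> i (Dom J u)" if u: "u \<in> Arr J" for u
  proof -
    have "FArr F u \<in> hom C (FObj F (Dom J u)) (FObj F (Cod J u))"
      using u by (intro cat_functor.FArr_hom[OF F]) (simp add: hom_def)
    moreover have "i (Cod J u) \<in> hom C (FObj F (Cod J u)) L"
      using is_colimitD(2)[OF L] u category.Cod_in[OF J] by blast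
    ultimately show ?thesis
      using Comp_assoc[OF _ _ h'] is_colimitD(3)[OF L u] by metis
  qed
  then have "is_cocone C J F T (\<lambda>x. h' \<cdot> i x)"
    using hom_Obj(2)[OF h'] Comp_hom[OF is_colimitD(2)[OF L] h'] by (simp add: is_cocone_def)
  then have "\<exists>!k. k \<in> hom C L T \<and> (\<forall>x\<in>Obj J. k \<cdot> i x = h' \<cdot> i x)"
    using L by (simp add: is_colimit_def)
  then show ?thesis using h h' eq by blast
qed

lemma is_isoE:
  assumes "is_iso C f" "f \<in> hom C a b"
  obtains g where "g \<in> hom C b a" "g \<cdot> f = Ident C a" "f \<cdot> g = Ident C b"
proof -
  obtain g where "is_inverse C f g" using assms(1) by (auto simp: is_iso_def)
  then show thesis
    by (intro that[of g]) (simp_all add: is_inverse_def homD(2,3)[OF assms(2)])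
qed

lemma isomorphicI:
  assumes "f \<in> hom C a b" "g \<in> hom C b a" "g \<cdot> f = Ident C a" "f \<cdot> g = Ident C b"
  shows "isomorphic C a b"
proof -
  have "is_inverse C f g" using assms by (simp add: is_inverse_def hom_def)
  then show ?thesis using homD(1)[OF assms(1)] assms(1) unfolding isomorphic_def is_iso_def by blast
qed

lemma is_coproduct_isomorphic:
  assumes P: "is_coproduct C A F P i" and Q: "is_coproduct C A F Q j"
  shows "isomorphic C P Q"
proof -
  note PD = is_coproductD[OF P] and QD = is_coproductD[OF Q]
  obtain f where f: "f \<in> hom C P Q" "\<And>x. x \<in> A \<Longrightarrow> f \<cdot> i x = j x"
    by (rule is_coproduct_copair[OF P, of Q j]) (use QD in auto)
  obtain g where g: "g \<in> hom C Q P" "\<And>x. x \<in> A \<Longrightarrow> g \<cdot> j x = i x"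
    by (rule is_coproduct_copair[OF Q, of P i]) (use PD in auto)
  have "g \<cdot> f = Ident C P"
  proof (rule is_coproduct_eqI[OF P])
    fix x assume x: "x \<in> A"
    have "g \<cdot> f \<cdot> i x = g \<cdot> (f \<cdot> i x)" using Comp_assoc[OF PD(2)[OF x] f(1) g(1)] .
    then show "g \<cdot> f \<cdot> i x = Ident C P \<cdot> i x"
      by (simp add: f(2) g(2) x Ident_Comp[OF PD(2)])
  qed (fact Comp_hom[OF f(1) g(1)] Ident_hom[OF PD(1)])+
  moreover have "f \<cdot> g = Ident C Q"
  proof (rule is_coproduct_eqI[OF Q])
    fix x assume x: "x \<in> A"
    have "f \<cdot> g \<cdot> j x = f \<cdot> (g \<cdot> j x)" using Comp_assoc[OF QD(2)[OF x] g(1) f(1)] .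
    then show "f \<cdot> g \<cdot> j x = Ident C Q \<cdot> j x"
      by (simp add: f(2) g(2) x Ident_Comp[OF QD(2)])
  qed (fact Comp_hom[OF g(1) f(1)] Ident_hom[OF QD(1)])+
  ultimately show ?thesis
    by (rule isomorphicI[OF f(1) g(1)])
qed

text \<open>Associativity of coproducts: a map out of \<open>R\<close> is a map out of
  \<open>P\<close> together with one out of \<open>F a\<close>, and the former is a family over
  \<open>A\<close>. Since \<open>a\<close> lies outside \<open>A\<close>, the case distinction
  leaves the legs over \<open>A\<close> intact. In the main induction \<open>a\<close> is the
  identity of \<open>[n]\<close> and \<open>A\<close> consists of the proper surjections.\<close>

lemma is_coproduct_insert:
  assumes P: "is_coproduct C A F P i" and "a \<notin> A"
    and l: "l \<in> hom C P R" and r: "r \<in> hom C (F a) R"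
    and R: "is_coproduct C UNIV (case_bool P (F a)) R (case_bool l r)"
  shows "is_coproduct C (insert a A) F R (\<lambda>x. if x = a then r else l \<cdot> i x)"
  unfolding is_coproduct_def
proof (intro conjI ballI allI impI)
  note PD = is_coproductD[OF P]
  show "R \<in> Obj C" using R by (rule is_coproductD)
  show "(if x = a then r else l \<cdot> i x) \<in> hom C (F x) R" if "x \<in> insert a A" for x
    using that r Comp_hom[OF PD(2) l] by (cases "x = a") simp_all
  fix T g assume *: "T \<in> Obj C \<and> (\<forall>x\<in>insert a A. g x \<in> hom C (F x) T)"
  then have T: "T \<in> Obj C" and g: "\<And>x. x \<in> A \<Longrightarrow> g x \<in> hom C (F x) T" and ga: "g a \<in> hom C (F a) T"
    by auto
  \<comment> \<open>The members of the family over \<open>A\<close> are first assembled into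
    \<open>p\<close>; the binary coproduct then pairs \<open>p\<close> with
    \<open>g a\<close>.\<close>
  obtain p where p: "p \<in> hom C P T" "\<And>x. x \<in> A \<Longrightarrow> p \<cdot> i x = g x"
    by (rule is_coproduct_copair[OF P T, of g]) (use g in auto)
  obtain h where h: "h \<in> hom C R T" "\<And>b. h \<cdot> case_bool l r b = case_bool p (g a) b"
  proof (rule is_coproduct_copair[OF R T])
    show "case_bool p (g a) b \<in> hom C (case_bool P (F a) b) T" for b
      using p(1) ga by (cases b) simp_all
  qed simp
  have h': "h \<cdot> l = p" "h \<cdot> r = g a" using h(2)[of True] h(2)[of False] by auto
  have assoc: "k \<cdot> (l \<cdot> i x) = k \<cdot> l \<cdot> i x" if "k \<in> hom C R T" "x \<in> A" for k x
    using Comp_assoc[OF PD(2) l] that by simp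
  show "\<exists>!h. h \<in> hom C R T \<and> (\<forall>x\<in>insert a A. h \<cdot> (if x = a then r else l \<cdot> i x) = g x)"
  proof (rule ex1I[of _ h])
    show "h \<in> hom C R T \<and> (\<forall>x\<in>insert a A. h \<cdot> (if x = a then r else l \<cdot> i x) = g x)"
      using h(1) h' p(2) assoc[OF h(1)] by simp
    fix k assume k: "k \<in> hom C R T \<and> (\<forall>x\<in>insert a A. k \<cdot> (if x = a then r else l \<cdot> i x) = g x)"
    then have kT: "k \<in> hom C R T" by blast
    have "k \<cdot> l = p"
    proof (rule is_coproduct_eqI[OF P])
      show "k \<cdot> l \<in> hom C P T" using Comp_hom[OF l kT] .
      fix x assume x: "x \<in> A"
      then have "k \<cdot> (l \<cdot> i x) = g x" using k \<open>a \<notin> A\<close> by (metis insertCI)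
      then show "k \<cdot> l \<cdot> i x = p \<cdot> i x" using assoc[OF kT x] p(2)[OF x] by simp
    qed (rule p)
    moreover have "k \<cdot> r = g a" using k by (metis insertI1)
    ultimately have "k \<cdot> case_bool l r b = h \<cdot> case_bool l r b" for b
      using h' by (cases b) simp_all
    then show "k = h" by (rule is_coproduct_eqI[OF R kT h(1)])
  qed
qed

text \<open>An arrow isomorphic to a coprojection is itself a leg of a coproduct with the same
  complement \<open>b\<close>. This turns the definition of a non-degenerate part, which is up to
  isomorphism of arrows, into a decomposition whose left leg is exactly \<open>d\<close>. The
  isomorphism \<open>u\<close> of sources is arbitrary, so it has to be undone on the left
  summand.\<close>

lemma is_coproduct_pull_iso:
  assumes P: "is_coproduct C UNIV (case_bool a b) P i"
    and d: "d \<in> hom C a' c" and u: "u \<in> hom C a' a" "is_iso C u"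
    and v: "v \<in> hom C c P" "is_iso C v" and sq: "v \<cdot> d = i True \<cdot> u"
  shows "\<exists>r \<in> hom C b c. is_coproduct C UNIV (case_bool a' b) c (case_bool d r)"
proof -
  obtain u' where u': "u' \<in> hom C a a'" "u' \<cdot> u = Ident C a'" "u \<cdot> u' = Ident C a"
    using is_isoE[OF u(2,1)] by blast
  obtain v' where v': "v' \<in> hom C P c" "v' \<cdot> v = Ident C c" "v \<cdot> v' = Ident C P"
    using is_isoE[OF v(2,1)] by blast
  have i: "i True \<in> hom C a P" "i False \<in> hom C b P"
    using is_coproductD(2)[OF P, of True] is_coproductD(2)[OF P, of False] by auto
  \<comment> \<open>The complement enters \<open>P\<close> by its coprojection and is carried back
    to \<open>c\<close> by the inverse of \<open>v\<close>.\<close>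
  define r where "r = v' \<cdot> i False"
  have r: "r \<in> hom C b c" unfolding r_def using i v' Comp_hom by blast
  have vr: "v \<cdot> r = i False"
    unfolding r_def using Comp_assoc[OF i(2) v'(1) v(1)] v'(3) Ident_Comp[OF i(2)] by simp
  have "is_coproduct C UNIV (case_bool a' b) c (case_bool d r)"
    unfolding is_coproduct_def
  proof (intro conjI ballI allI impI)
    show "c \<in> Obj C" using d hom_Obj by blast
    show "case_bool d r x \<in> hom C (case_bool a' b x) c" for x
      using d r by (auto split: bool.splits)
    fix T g assume *: "T \<in> Obj C \<and> (\<forall>x\<in>UNIV. g x \<in> hom C (case_bool a' b x) T)"
    then have T: "T \<in> Obj C" and g: "g True \<in> hom C a' T" "g False \<in> hom C b T"
      by (auto dest: spec[of _ True] spec[of _ False])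
    \<comment> \<open>\<open>g True\<close> starts at \<open>a'\<close>, whereas the summand of
      \<open>P\<close> is \<open>a\<close>; the inverse of \<open>u\<close> mediates.\<close>
    have gu: "g True \<cdot> u' \<in> hom C a T" using g u' Comp_hom by blast
    obtain h where h: "h \<in> hom C P T"
      "\<And>x. h \<cdot> i x = case_bool (g True \<cdot> u') (g False) x"
      by (rule is_coproduct_copair[OF P T, of "case_bool (g True \<cdot> u') (g False)"])
        (use gu g in \<open>auto split: bool.splits\<close>)
    have hv: "h \<cdot> v \<in> hom C c T" using h v Comp_hom by blast
    have ex: "h \<cdot> v \<cdot> case_bool d r x = g x" for x
    proof (cases x)
      case True
      have "h \<cdot> v \<cdot> d = h \<cdot> (i True \<cdot> u)" using Comp_assoc[OF d v(1) h(1)] sq by simp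
      also have "\<dots> = g True \<cdot> u' \<cdot> u"
        using Comp_assoc[OF u(1) i(1) h(1)] h(2)[of True] by simp
      also have "\<dots> = g True"
        using Comp_assoc[OF u(1) u'(1) g(1)] u'(2) Comp_Ident[OF g(1)] by simp
      finally show ?thesis using True by simp
    next
      case False
      then show ?thesis using Comp_assoc[OF r v(1) h(1)] vr h(2)[of False] by simp
    qed
    show "\<exists>!h. h \<in> hom C c T \<and> (\<forall>x\<in>UNIV. h \<cdot> case_bool d r x = g x)"
    proof (rule ex1I[of _ "h \<cdot> v"])
      show "h \<cdot> v \<in> hom C c T \<and> (\<forall>x\<in>UNIV. h \<cdot> v \<cdot> case_bool d r x = g x)"
        using hv ex by simp
      fix k assume k: "k \<in> hom C c T \<and> (\<forall>x\<in>UNIV. k \<cdot> case_bool d r x = g x)"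
      then have kT: "k \<in> hom C c T" and kd: "k \<cdot> d = g True" "k \<cdot> r = g False"
        by (auto dest: spec[of _ True] spec[of _ False])
      have kv: "k \<cdot> v' \<in> hom C P T" using kT v' Comp_hom by blast
      \<comment> \<open>The commuting square with both isomorphisms inverted. It computes the left
        component of \<open>k \<cdot> v'\<close>, so that this arrow can be compared with
        \<open>h\<close> on both summands.\<close>
      have "v' \<cdot> i True = d \<cdot> u'"
      proof -
        have "i True = i True \<cdot> u \<cdot> u'"
          using Comp_assoc[OF u'(1) u(1) i(1)] u'(3) Comp_Ident[OF i(1)] by simp
        also have "\<dots> = v \<cdot> (d \<cdot> u')" using sq Comp_assoc[OF u'(1) d v(1)] by simp
        finally have "v' \<cdot> i True = v' \<cdot> v \<cdot> (d \<cdot> u')"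
          using Comp_assoc[OF Comp_hom[OF u'(1) d] v(1) v'(1)] by simp
        then show ?thesis using v'(2) Ident_Comp Comp_hom[OF u'(1) d] by simp
      qed
      then have "k \<cdot> v' \<cdot> i True = h \<cdot> i True"
        using Comp_assoc[OF i(1) v'(1) kT] Comp_assoc[OF u'(1) d kT] kd h(2)[of True] by simp
      moreover have "k \<cdot> v' \<cdot> i False = h \<cdot> i False"
        using Comp_assoc[OF i(2) v'(1) kT] kd h(2)[of False] by (simp add: r_def)
      ultimately have "k \<cdot> v' = h"
        by (intro is_coproduct_eqI[OF P kv h(1)]) (metis (full_types))
      then show "k = h \<cdot> v"
        using Comp_assoc[OF v(1) v'(1) kT] v'(2) Comp_Ident[OF kT] by simp
    qed
  qed
  then show ?thesis using r by blast
qed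

end

section \<open>Surjections in the simplex category\<close>

lemma Delta_surj_simps [simp]:
  "Obj Delta_surj = UNIV" "Dom Delta_surj (m, k, f) = m" "Cod Delta_surj (m, k, f) = k"
  "Ident Delta_surj m = (m, m, \<lambda>i\<in>{..m}. i)"
  "(k, l, g) \<cdot>\<^bsub>Delta_surj\<^esub> (m, k', f) = (m, l, \<lambda>i\<in>{..m}. g (f i))"
  by (simp_all add: Delta_surj_def Delta_f_def)

lemma Arr_Delta_surj:
  "(m, k, f) \<in> Arr Delta_surj \<longleftrightarrow>
     f \<in> {..m} \<rightarrow>\<^sub>E {..k} \<and> mono_on {..m} f \<and> f 0 = 0 \<and> f m = k \<and> f ` {..m} = {..k}"
  by (auto simp: Delta_surj_def Delta_f_def)

lemma hom_Delta_surjE: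
  assumes "\<sigma> \<in> hom Delta_surj m k"
  obtains f where "\<sigma> = (m, k, f)" "f \<in> {..m} \<rightarrow>\<^sub>E {..k}" "mono_on {..m} f" "f 0 = 0" "f m = k"
    "f ` {..m} = {..k}"
  using assms by (cases \<sigma>) (auto simp: hom_def Arr_Delta_surj)

lemma category_Delta_surj: "category Delta_surj"
proof
  fix a b c f g
  assume f: "f \<in> hom Delta_surj a b" and g: "g \<in> hom Delta_surj b c"
  obtain f' where f': "f = (a, b, f')" "f' \<in> {..a} \<rightarrow>\<^sub>E {..b}" "mono_on {..a} f'" "f' 0 = 0"
    "f' a = b" "f' ` {..a} = {..b}" using f by (rule hom_Delta_surjE)
  obtain g' where g': "g = (b, c, g')" "g' \<in> {..b} \<rightarrow>\<^sub>E {..c}" "mono_on {..b} g'" "g' 0 = 0"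
    "g' b = c" "g' ` {..b} = {..c}" using g by (rule hom_Delta_surjE)
  have "restrict (\<lambda>i. g' (f' i)) {..a} ` {..a} = {..c}"
    using f'(6) g'(6) by (metis image_image image_restrict_eq)
  moreover have "mono_on {..a} (\<lambda>i\<in>{..a}. g' (f' i))"
    using f'(2,3) g'(3) by (auto simp: mono_on_def PiE_iff)
  moreover have "(\<lambda>i\<in>{..a}. g' (f' i)) \<in> {..a} \<rightarrow>\<^sub>E {..c}"
    using f'(2) g'(2) by (auto simp: PiE_iff)
  ultimately show "g \<cdot>\<^bsub>Delta_surj\<^esub> f \<in> hom Delta_surj a c"
    using f' g' by (simp add: hom_def Arr_Delta_surj)
next
  fix a :: nat
  show "Ident Delta_surj a \<in> hom Delta_surj a a"
    by (auto simp: hom_def Arr_Delta_surj mono_on_def)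
next
  fix a b f assume "f \<in> hom Delta_surj a b"
  then obtain f' where f': "f = (a, b, f')" "f' \<in> {..a} \<rightarrow>\<^sub>E {..b}" by (rule hom_Delta_surjE)
  then show "f \<cdot>\<^bsub>Delta_surj\<^esub> Ident Delta_surj a = f" "Ident Delta_surj b \<cdot>\<^bsub>Delta_surj\<^esub> f = f"
    by (auto simp: PiE_iff extensional_def restrict_def fun_eq_iff)
next
  fix a b c d f g h
  assume "f \<in> hom Delta_surj a b" "g \<in> hom Delta_surj b c" "h \<in> hom Delta_surj c d"
  then show "h \<cdot>\<^bsub>Delta_surj\<^esub> g \<cdot>\<^bsub>Delta_surj\<^esub> f = h \<cdot>\<^bsub>Delta_surj\<^esub> (g \<cdot>\<^bsub>Delta_surj\<^esub> f)"
    by (elim hom_Delta_surjE) (auto simp: PiE_iff restrict_def fun_eq_iff)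
qed simp_all

interpretation Delta_surj: category Delta_surj
  by (rule category_Delta_surj)

text \<open>A monotone map onto an initial segment cannot skip a value, so it rises by at most one
  at each step. This bound yields both that surjections do not raise dimension and that those
  preserving it are identities.\<close>

lemma Delta_surj_step:
  fixes f :: "nat \<Rightarrow> nat"
  assumes f: "mono_on {..m} f" "f ` {..m} = {..k}" and "i \<le> j" "j \<le> m"
  shows "f j \<le> f i + (j - i)"
  using assms(3,4)
proof (induction j rule: dec_induct)
  case (step j)
  have "f (Suc j) \<le> Suc (f j)"
  proof (rule ccontr)
    assume *: "\<not> ?thesis"
    have "f (Suc j) \<in> {..k}" using f(2) step.prems by blast
    \<comment> \<open>The skipped value lies strictly between \<open>f j\<close> and
      \<open>f (Suc j)\<close>, hence is attained at some \<open>x\<close>. Monotonicity leaves no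
      room for \<open>x\<close>, neither up to \<open>j\<close> nor beyond it.\<close>
    then have "Suc (f j) \<in> f ` {..m}" using * f(2) by auto
    then obtain x where x: "x \<le> m" "f x = Suc (f j)" by auto
    show False
    proof (cases "x \<le> j")
      case True
      then have "f x \<le> f j" by (intro mono_onD[OF f(1)]) (use step.prems x in auto)
      then show False using x by simp
    next
      case False
      then have "f (Suc j) \<le> f x" by (intro mono_onD[OF f(1)]) (use step.prems x in auto)
      then show False using x * by simp
    qed
  qed
  then show ?case using step by simp
qed simp

lemma surjections_iff: "\<sigma> \<in> surjections n \<longleftrightarrow> \<sigma> \<in> hom Delta_surj n (Cod Delta_surj \<sigma>)"
  by (auto simp: surjections_def hom_def)

lemma Cod_surjections_le:
  assumes "\<sigma> \<in> surjections n"
  shows "Cod Delta_surj \<sigma> \<le> n"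
proof -
  obtain f where f: "\<sigma> = (n, Cod Delta_surj \<sigma>, f)" "mono_on {..n} f" "f 0 = 0"
    "f n = Cod Delta_surj \<sigma>" "f ` {..n} = {..Cod Delta_surj \<sigma>}"
    using assms unfolding surjections_iff by (rule hom_Delta_surjE)
  show ?thesis using Delta_surj_step[OF f(2,5), of 0 n] f by simp
qed

text \<open>The step bound applied between \<open>0\<close> and \<open>i\<close> gives
  \<open>f i \<le> i\<close>, and applied between \<open>i\<close> and \<open>n\<close> it gives
  \<open>i \<le> f i\<close>, because both endpoints are fixed.\<close>

lemma surjection_Cod_eq:
  assumes "\<sigma> \<in> surjections n" "Cod Delta_surj \<sigma> = n"
  shows "\<sigma> = Ident Delta_surj n"
proof -
  obtain f where f: "\<sigma> = (n, n, f)" "f \<in> {..n} \<rightarrow>\<^sub>E {..n}" "mono_on {..n} f" "f 0 = 0"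
    "f n = n" "f ` {..n} = {..n}"
    using assms unfolding surjections_iff by (metis hom_Delta_surjE)
  have "f i = i" if "i \<le> n" for i
    using Delta_surj_step[OF f(3,6), of 0 i] Delta_surj_step[OF f(3,6), of i n] that f(4,5) by simp
  then show ?thesis using f(1,2) by (auto simp: PiE_iff extensional_def fun_eq_iff)
qed

section \<open>The index category of the degenerate part\<close>

lemma Obj_deg_index: "Obj (deg_index n) = {\<sigma> \<in> surjections n. Cod Delta_surj \<sigma> < n}"
  by (simp add: deg_index_def)

text \<open>Matches the splitting of \<open>X\<close> at \<open>n\<close>: the identity accounts for
  the non-degenerate part in dimension \<open>n\<close>, the proper surjections for the degenerate
  part.\<close>

lemma surjections_eq_insert: "surjections n = insert (Ident Delta_surj n) (Obj (deg_index n))"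
proof -
  have "Ident Delta_surj n \<in> surjections n"
    using Delta_surj.Ident_hom[of n] by (simp add: surjections_iff)
  moreover have "Cod Delta_surj \<sigma> < n \<or> \<sigma> = Ident Delta_surj n" if "\<sigma> \<in> surjections n" for \<sigma>
    using Cod_surjections_le[OF that] surjection_Cod_eq[OF that] by linarith
  ultimately show ?thesis
    unfolding Obj_deg_index by blast
qed

lemma hom_deg_indexE:
  assumes "u \<in> hom (deg_index n) \<sigma> \<rho>"
  obtains \<tau> where "u = (\<sigma>, \<tau>, \<rho>)" "\<tau> \<in> hom Delta_surj (Cod Delta_surj \<sigma>) (Cod Delta_surj \<rho>)"
    "\<tau> \<cdot>\<^bsub>Delta_surj\<^esub> \<sigma> = \<rho>" "\<sigma> \<in> Obj (deg_index n)" "\<rho> \<in> Obj (deg_index n)"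
  using assms by (cases u) (auto simp: deg_index_def hom_def)

lemma deg_index_simps [simp]:
  "Dom (deg_index n) (\<sigma>, \<tau>, \<rho>) = \<sigma>" "Cod (deg_index n) (\<sigma>, \<tau>, \<rho>) = \<rho>"
  "Ident (deg_index n) \<sigma> = (\<sigma>, Ident Delta_surj (Cod Delta_surj \<sigma>), \<sigma>)"
  "(\<sigma>', \<tau>', \<rho>') \<cdot>\<^bsub>deg_index n\<^esub> (\<sigma>, \<tau>, \<rho>) = (\<sigma>, \<tau>' \<cdot>\<^bsub>Delta_surj\<^esub> \<tau>, \<rho>')"
  by (simp_all add: deg_index_def)

lemma Obj_deg_index_hom:
  "\<sigma> \<in> Obj (deg_index n) \<Longrightarrow> \<sigma> \<in> hom Delta_surj n (Cod Delta_surj \<sigma>)"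
  by (simp add: Obj_deg_index surjections_iff)

lemma hom_deg_indexI:
  assumes "\<tau> \<in> hom Delta_surj (Cod Delta_surj \<sigma>) (Cod Delta_surj \<rho>)"
    "\<tau> \<cdot>\<^bsub>Delta_surj\<^esub> \<sigma> = \<rho>" "\<sigma> \<in> Obj (deg_index n)" "\<rho> \<in> Obj (deg_index n)"
  shows "(\<sigma>, \<tau>, \<rho>) \<in> hom (deg_index n) \<sigma> \<rho>"
  using assms by (auto simp: deg_index_def hom_def)

lemma category_deg_index: "category (deg_index n)"
proof
  fix u assume "u \<in> Arr (deg_index n)"
  then show "Dom (deg_index n) u \<in> Obj (deg_index n)" "Cod (deg_index n) u \<in> Obj (deg_index n)"
    by (auto simp: deg_index_def)
next
  fix \<sigma> assume \<sigma>: "\<sigma> \<in> Obj (deg_index n)"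
  show "Ident (deg_index n) \<sigma> \<in> hom (deg_index n) \<sigma> \<sigma>"
    unfolding deg_index_simps
    by (rule hom_deg_indexI[OF Delta_surj.Ident_hom Delta_surj.Ident_Comp[OF Obj_deg_index_hom[OF \<sigma>]] \<sigma> \<sigma>])
      simp
next
  fix a b c u v assume u: "u \<in> hom (deg_index n) a b" and v: "v \<in> hom (deg_index n) b c"
  obtain \<tau> where \<tau>: "u = (a, \<tau>, b)" "\<tau> \<in> hom Delta_surj (Cod Delta_surj a) (Cod Delta_surj b)"
    "\<tau> \<cdot>\<^bsub>Delta_surj\<^esub> a = b" "a \<in> Obj (deg_index n)" using hom_deg_indexE[OF u] .
  obtain \<rho> where \<rho>: "v = (b, \<rho>, c)" "\<rho> \<in> hom Delta_surj (Cod Delta_surj b) (Cod Delta_surj c)"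
    "\<rho> \<cdot>\<^bsub>Delta_surj\<^esub> b = c" "c \<in> Obj (deg_index n)" using hom_deg_indexE[OF v] .
  show "v \<cdot>\<^bsub>deg_index n\<^esub> u \<in> hom (deg_index n) a c"
    unfolding \<tau>(1) \<rho>(1) deg_index_simps
  proof (rule hom_deg_indexI[OF Delta_surj.Comp_hom[OF \<tau>(2) \<rho>(2)] _ \<tau>(4) \<rho>(4)])
    show "\<rho> \<cdot>\<^bsub>Delta_surj\<^esub> \<tau> \<cdot>\<^bsub>Delta_surj\<^esub> a = c"
      using Delta_surj.Comp_assoc[OF Obj_deg_index_hom[OF \<tau>(4)] \<tau>(2) \<rho>(2)] \<tau>(3) \<rho>(3) by simp
  qed
next
  fix a b u assume u: "u \<in> hom (deg_index n) a b"
  obtain \<tau> where \<tau>: "u = (a, \<tau>, b)" "\<tau> \<in> hom Delta_surj (Cod Delta_surj a) (Cod Delta_surj b)"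
    using hom_deg_indexE[OF u] .
  show "u \<cdot>\<^bsub>deg_index n\<^esub> Ident (deg_index n) a = u"
    "Ident (deg_index n) b \<cdot>\<^bsub>deg_index n\<^esub> u = u"
    unfolding \<tau>(1) deg_index_simps Delta_surj.Comp_Ident[OF \<tau>(2)] Delta_surj.Ident_Comp[OF \<tau>(2)]
    by (rule refl)+
next
  fix a b c d u v w
  assume u: "u \<in> hom (deg_index n) a b" and v: "v \<in> hom (deg_index n) b c"
    and w: "w \<in> hom (deg_index n) c d"
  obtain \<tau> where \<tau>: "u = (a, \<tau>, b)" "\<tau> \<in> hom Delta_surj (Cod Delta_surj a) (Cod Delta_surj b)"
    using hom_deg_indexE[OF u] .
  obtain \<rho> where \<rho>: "v = (b, \<rho>, c)" "\<rho> \<in> hom Delta_surj (Cod Delta_surj b) (Cod Delta_surj c)"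
    using hom_deg_indexE[OF v] .
  obtain \<pi> where \<pi>: "w = (c, \<pi>, d)" "\<pi> \<in> hom Delta_surj (Cod Delta_surj c) (Cod Delta_surj d)"
    using hom_deg_indexE[OF w] .
  show "w \<cdot>\<^bsub>deg_index n\<^esub> v \<cdot>\<^bsub>deg_index n\<^esub> u = w \<cdot>\<^bsub>deg_index n\<^esub> (v \<cdot>\<^bsub>deg_index n\<^esub> u)"
    unfolding \<tau>(1) \<rho>(1) \<pi>(1) deg_index_simps Delta_surj.Comp_assoc[OF \<tau>(2) \<rho>(2) \<pi>(2)]
    by (rule refl)
qed

lemma finite_surjections: "finite (surjections n)"
proof (rule finite_subset)
  show "surjections n \<subseteq> (\<Union>k\<le>n. (\<lambda>f. (n, k, f)) ` ({..n} \<rightarrow>\<^sub>E {..k}))"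
  proof
    fix \<sigma> assume \<sigma>: "\<sigma> \<in> surjections n"
    then have "\<sigma> \<in> hom Delta_surj n (Cod Delta_surj \<sigma>)" by (simp add: surjections_iff)
    then show "\<sigma> \<in> (\<Union>k\<le>n. (\<lambda>f. (n, k, f)) ` ({..n} \<rightarrow>\<^sub>E {..k}))"
      using Cod_surjections_le[OF \<sigma>] by (elim hom_Delta_surjE) auto
  qed
  show "finite (\<Union>k\<le>n. (\<lambda>f. (n, k, f)) ` ({..n} \<rightarrow>\<^sub>E {..k}))"
    by (intro finite_UN_I finite_imageI finite_PiE) auto
qed

text \<open>A finite category can be copied into any infinite type; this is what makes the
  cocompleteness hypothesis applicable to the degenerate part.\<close>

lemma finite_deg_index: "finite (Obj (deg_index n))" "finite (Arr (deg_index n))"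
proof -
  show "finite (Obj (deg_index n))" by (simp add: Obj_deg_index finite_surjections)
  have "Arr (deg_index n) \<subseteq> surjections n \<times> (\<Union>k\<le>n. surjections k) \<times> surjections n"
    by (auto simp: deg_index_def surjections_def hom_def)
  then show "finite (Arr (deg_index n))"
    by (rule finite_subset) (auto intro: finite_surjections)
qed

section \<open>Decomposition into non-degenerate parts\<close>

lemma cat_functor_deg_diagram:
  assumes "cat_functor (opcat Delta_surj) W X"
  shows "cat_functor (opcat (deg_index n)) W (deg_diagram X)"
proof -
  interpret X: cat_functor "opcat Delta_surj" W X by fact
  show ?thesis
  proof
    fix a b c u v
    assume "u \<in> hom (opcat (deg_index n)) a b" "v \<in> hom (opcat (deg_index n)) b c"
    then show "FArr (deg_diagram X) (v \<cdot>\<^bsub>opcat (deg_index n)\<^esub> u) =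
      FArr (deg_diagram X) v \<cdot>\<^bsub>W\<^esub> FArr (deg_diagram X) u"
      using X.FArr_Comp by (auto elim!: hom_deg_indexE simp: deg_diagram_def simp del: Delta_surj_simps(4,5))
  next
    fix a b u assume "u \<in> hom (opcat (deg_index n)) a b"
    then show "FArr (deg_diagram X) u \<in> hom W (FObj (deg_diagram X) a) (FObj (deg_diagram X) b)"
      using X.FArr_hom by (auto elim!: hom_deg_indexE simp: deg_diagram_def)
  next
    fix a assume "a \<in> Obj (opcat (deg_index n))"
    then show "FObj (deg_diagram X) a \<in> Obj W"
      using X.FObj_in by (simp add: deg_diagram_def)
    show "FArr (deg_diagram X) (Ident (opcat (deg_index n)) a) = Ident W (FObj (deg_diagram X) a)"
      using X.FArr_Ident by (simp add: deg_diagram_def del: Delta_surj_simps(4))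
  qed
qed

text \<open>Compatibility of a cocone \<open>h\<close> forces the component of
  \<open>h \<sigma>\<close> on the summand \<open>\<tau>\<close> to be the component of
  \<open>h\<close> at \<open>\<tau>\<sigma>\<close> on the identity summand. So only the identity
  components are free, and cocones correspond to families indexed by the proper surjections.\<close>

lemma is_coproduct_deg:
  assumes W: "category W" and X: "cat_functor (opcat Delta_surj) W X"
    and L: "is_colimit W (opcat (deg_index n)) (deg_diagram X) L i"
    and j: "\<And>k. k < n \<Longrightarrow> j k \<in> hom W (N k) (FObj X k)"
    and IH: "\<And>k. k < n \<Longrightarrow> is_coproduct W (surjections k) (\<lambda>\<sigma>. N (Cod Delta_surj \<sigma>)) (FObj X k)
      (\<lambda>\<sigma>. FArr X \<sigma> \<cdot>\<^bsub>W\<^esub> j (Cod Delta_surj \<sigma>))"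
  shows "is_coproduct W (Obj (deg_index n)) (\<lambda>\<sigma>. N (Cod Delta_surj \<sigma>)) L
      (\<lambda>\<sigma>. i \<sigma> \<cdot>\<^bsub>W\<^esub> j (Cod Delta_surj \<sigma>))"
proof -
  interpret category W by fact
  interpret X: cat_functor "opcat Delta_surj" W X by fact
  note LD = is_colimitD[OF L]
  have J: "category (opcat (deg_index n))"
    by (rule category_opcat[OF category_deg_index])
  have F: "cat_functor (opcat (deg_index n)) W (deg_diagram X)"
    by (rule cat_functor_deg_diagram[OF X])
  have lt: "Cod Delta_surj \<sigma> < n" if "\<sigma> \<in> Obj (deg_index n)" for \<sigma>
    using that by (simp add: Obj_deg_index)
  \<comment> \<open>Composing a proper surjection with a further one stays proper, since the
    codomain can only drop.\<close>
  have comp: "\<tau> \<cdot>\<^bsub>Delta_surj\<^esub> \<sigma> \<in> Obj (deg_index n)"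
    "Cod Delta_surj (\<tau> \<cdot>\<^bsub>Delta_surj\<^esub> \<sigma>) = Cod Delta_surj \<tau>"
    if "\<sigma> \<in> Obj (deg_index n)" "\<tau> \<in> surjections (Cod Delta_surj \<sigma>)" for \<sigma> \<tau>
  proof -
    have *: "\<tau> \<cdot>\<^bsub>Delta_surj\<^esub> \<sigma> \<in> hom Delta_surj n (Cod Delta_surj \<tau>)"
      using Delta_surj.Comp_hom Obj_deg_index_hom that by (metis surjections_iff)
    then show "Cod Delta_surj (\<tau> \<cdot>\<^bsub>Delta_surj\<^esub> \<sigma>) = Cod Delta_surj \<tau>" by (rule homD)
    then show "\<tau> \<cdot>\<^bsub>Delta_surj\<^esub> \<sigma> \<in> Obj (deg_index n)"
      using * lt[OF that(1)] Cod_surjections_le[OF that(2)]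
      by (simp add: Obj_deg_index surjections_iff)
  qed
  have i: "i \<sigma> \<in> hom W (FObj X (Cod Delta_surj \<sigma>)) L" if "\<sigma> \<in> Obj (deg_index n)" for \<sigma>
    using LD(2)[of \<sigma>] that by (simp add: deg_diagram_def)
  \<comment> \<open>\<open>\<tau>\<close> is itself a morphism of the index category from
    \<open>\<sigma>\<close> to \<open>\<tau>\<sigma>\<close>, so the colimit legs are related along
    it.\<close>
  have cocone: "i \<sigma> \<cdot>\<^bsub>W\<^esub> FArr X \<tau> = i (\<tau> \<cdot>\<^bsub>Delta_surj\<^esub> \<sigma>)"
    if "\<sigma> \<in> Obj (deg_index n)" "\<tau> \<in> surjections (Cod Delta_surj \<sigma>)" for \<sigma> \<tau>
  proof -
    have "(\<sigma>, \<tau>, \<tau> \<cdot>\<^bsub>Delta_surj\<^esub> \<sigma>) \<in> hom (deg_index n) \<sigma> (\<tau> \<cdot>\<^bsub>Delta_surj\<^esub> \<sigma>)"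
      using that comp[OF that] by (intro hom_deg_indexI) (simp_all add: surjections_iff)
    then have "(\<sigma>, \<tau>, \<tau> \<cdot>\<^bsub>Delta_surj\<^esub> \<sigma>) \<in> Arr (opcat (deg_index n))"
      by (simp add: hom_def)
    from LD(3)[OF this] show ?thesis by (simp add: deg_diagram_def)
  qed
  have Xh: "FArr X \<tau> \<in> hom W (FObj X (Cod Delta_surj \<tau>)) (FObj X k)" if "\<tau> \<in> surjections k" for \<tau> k
    using X.FArr_hom that by (simp add: surjections_iff)
  have jh: "j (Cod Delta_surj \<tau>) \<in> hom W (N (Cod Delta_surj \<tau>)) (FObj X (Cod Delta_surj \<tau>))"
    if "\<tau> \<in> surjections k" "k < n" for \<tau> k
    using j Cod_surjections_le[OF that(1)] that(2) by simp
  show ?thesis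
    unfolding is_coproduct_def
  proof (intro conjI ballI allI impI)
    show "L \<in> Obj W" by fact
    fix \<sigma> assume "\<sigma> \<in> Obj (deg_index n)"
    then show "i \<sigma> \<cdot>\<^bsub>W\<^esub> j (Cod Delta_surj \<sigma>) \<in> hom W (N (Cod Delta_surj \<sigma>)) L"
      using i j lt Comp_hom by blast
  next
    fix T g assume *: "T \<in> Obj W \<and> (\<forall>\<sigma>\<in>Obj (deg_index n). g \<sigma> \<in> hom W (N (Cod Delta_surj \<sigma>)) T)"
    then have T: "T \<in> Obj W" by blast
    \<comment> \<open>The decomposition of \<open>X\<close> in the lower dimension, the codomain of
      \<open>\<sigma>\<close>, allows the components of \<open>h\<close> to be prescribed freely,
      summand by summand.\<close>
    have "\<exists>h. h \<in> hom W (FObj X (Cod Delta_surj \<sigma>)) T \<and> (\<forall>\<tau>\<in>surjections (Cod Delta_surj \<sigma>).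
        h \<cdot>\<^bsub>W\<^esub> (FArr X \<tau> \<cdot>\<^bsub>W\<^esub> j (Cod Delta_surj \<tau>)) = g (\<tau> \<cdot>\<^bsub>Delta_surj\<^esub> \<sigma>))"
      if \<sigma>: "\<sigma> \<in> Obj (deg_index n)" for \<sigma>
    proof -
      have "g (\<tau> \<cdot>\<^bsub>Delta_surj\<^esub> \<sigma>) \<in> hom W (N (Cod Delta_surj \<tau>)) T"
        if "\<tau> \<in> surjections (Cod Delta_surj \<sigma>)" for \<tau>
        using * comp[OF \<sigma> that] by metis
      then show ?thesis
        using is_coproduct_copair[OF IH[OF lt[OF \<sigma>]] T, of "\<lambda>\<tau>. g (\<tau> \<cdot>\<^bsub>Delta_surj\<^esub> \<sigma>)"] by metis
    qed
    then obtain h where h: "\<And>\<sigma>. \<sigma> \<in> Obj (deg_index n) \<Longrightarrow> h \<sigma> \<in> hom W (FObj X (Cod Delta_surj \<sigma>)) T"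
      and hg: "\<And>\<sigma> \<tau>. \<sigma> \<in> Obj (deg_index n) \<Longrightarrow> \<tau> \<in> surjections (Cod Delta_surj \<sigma>) \<Longrightarrow>
        h \<sigma> \<cdot>\<^bsub>W\<^esub> (FArr X \<tau> \<cdot>\<^bsub>W\<^esub> j (Cod Delta_surj \<tau>)) = g (\<tau> \<cdot>\<^bsub>Delta_surj\<^esub> \<sigma>)"
      by metis
    \<comment> \<open>By contravariance, precomposition with \<open>X(\<rho>)\<close> carries the
      summand \<open>\<tau>\<close> to the summand \<open>\<tau>\<rho>\<close>. Both sides therefore
      have component \<open>g (\<tau>\<rho>\<sigma>)\<close>, up to rebracketing.\<close>
    have hcomp: "h \<sigma> \<cdot>\<^bsub>W\<^esub> FArr X \<rho> = h (\<rho> \<cdot>\<^bsub>Delta_surj\<^esub> \<sigma>)"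
      if \<sigma>: "\<sigma> \<in> Obj (deg_index n)" and \<rho>: "\<rho> \<in> surjections (Cod Delta_surj \<sigma>)" for \<sigma> \<rho>
    proof -
      let ?k = "Cod Delta_surj \<rho>"
      have k: "?k < n" using lt[OF comp(1)[OF \<sigma> \<rho>]] comp(2)[OF \<sigma> \<rho>] by simp
      show ?thesis
      proof (rule is_coproduct_eqI[OF IH[OF k]])
        show "h \<sigma> \<cdot>\<^bsub>W\<^esub> FArr X \<rho> \<in> hom W (FObj X ?k) T" using Comp_hom[OF Xh[OF \<rho>] h[OF \<sigma>]] .
        show "h (\<rho> \<cdot>\<^bsub>Delta_surj\<^esub> \<sigma>) \<in> hom W (FObj X ?k) T"
          using h[OF comp(1)[OF \<sigma> \<rho>]] comp(2)[OF \<sigma> \<rho>] by simp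
        fix \<tau> assume \<tau>: "\<tau> \<in> surjections ?k"
        let ?j = "j (Cod Delta_surj \<tau>)"
        have \<rho>\<tau>: "\<rho> \<in> hom Delta_surj (Cod Delta_surj \<sigma>) ?k" "\<tau> \<in> hom Delta_surj ?k (Cod Delta_surj \<tau>)"
          using \<rho> \<tau> by (simp_all add: surjections_iff)
        have c: "\<tau> \<cdot>\<^bsub>Delta_surj\<^esub> \<rho> \<in> hom Delta_surj (Cod Delta_surj \<sigma>) (Cod Delta_surj \<tau>)"
          using Delta_surj.Comp_hom[OF \<rho>\<tau>] .
        have Xc: "FArr X (\<tau> \<cdot>\<^bsub>Delta_surj\<^esub> \<rho>) = FArr X \<rho> \<cdot>\<^bsub>W\<^esub> FArr X \<tau>"
          using X.FArr_Comp[of \<tau> "Cod Delta_surj \<tau>" ?k \<rho> "Cod Delta_surj \<sigma>"] \<rho>\<tau> by simp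
        have Xj: "FArr X \<tau> \<cdot>\<^bsub>W\<^esub> ?j \<in> hom W (N (Cod Delta_surj \<tau>)) (FObj X ?k)"
          using Comp_hom[OF jh[OF \<tau> k] Xh[OF \<tau>]] .
        have "h \<sigma> \<cdot>\<^bsub>W\<^esub> FArr X \<rho> \<cdot>\<^bsub>W\<^esub> (FArr X \<tau> \<cdot>\<^bsub>W\<^esub> ?j) =
            h \<sigma> \<cdot>\<^bsub>W\<^esub> (FArr X \<rho> \<cdot>\<^bsub>W\<^esub> FArr X \<tau> \<cdot>\<^bsub>W\<^esub> ?j)"
          using Comp_assoc[OF Xj Xh[OF \<rho>] h[OF \<sigma>]] Comp_assoc[OF jh[OF \<tau> k] Xh[OF \<tau>] Xh[OF \<rho>]] by simp
        also have "\<dots> = h \<sigma> \<cdot>\<^bsub>W\<^esub> (FArr X (\<tau> \<cdot>\<^bsub>Delta_surj\<^esub> \<rho>) \<cdot>\<^bsub>W\<^esub> j (Cod Delta_surj (\<tau> \<cdot>\<^bsub>Delta_surj\<^esub> \<rho>)))"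
          using Xc homD(3)[OF c] by simp
        also have "\<dots> = g (\<tau> \<cdot>\<^bsub>Delta_surj\<^esub> \<rho> \<cdot>\<^bsub>Delta_surj\<^esub> \<sigma>)"
          using hg[OF \<sigma>, of "\<tau> \<cdot>\<^bsub>Delta_surj\<^esub> \<rho>"] c homD(3)[OF c] by (simp add: surjections_iff)
        also have "\<dots> = g (\<tau> \<cdot>\<^bsub>Delta_surj\<^esub> (\<rho> \<cdot>\<^bsub>Delta_surj\<^esub> \<sigma>))"
          using Delta_surj.Comp_assoc[OF Obj_deg_index_hom[OF \<sigma>] \<rho>\<tau>] by simp
        also have "\<dots> = h (\<rho> \<cdot>\<^bsub>Delta_surj\<^esub> \<sigma>) \<cdot>\<^bsub>W\<^esub> (FArr X \<tau> \<cdot>\<^bsub>W\<^esub> ?j)"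
          using hg[OF comp(1)[OF \<sigma> \<rho>], of \<tau>] comp(2)[OF \<sigma> \<rho>] \<tau> by simp
        finally show "h \<sigma> \<cdot>\<^bsub>W\<^esub> FArr X \<rho> \<cdot>\<^bsub>W\<^esub> (FArr X \<tau> \<cdot>\<^bsub>W\<^esub> ?j) =
          h (\<rho> \<cdot>\<^bsub>Delta_surj\<^esub> \<sigma>) \<cdot>\<^bsub>W\<^esub> (FArr X \<tau> \<cdot>\<^bsub>W\<^esub> ?j)" .
      qed
    qed
    have "is_cocone W (opcat (deg_index n)) (deg_diagram X) T h"
      unfolding is_cocone_def
    proof (intro conjI ballI)
      show "T \<in> Obj W" by fact
      show "h \<sigma> \<in> hom W (FObj (deg_diagram X) \<sigma>) T" if "\<sigma> \<in> Obj (opcat (deg_index n))" for \<sigma>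
        using h that by (simp add: deg_diagram_def)
      fix u assume "u \<in> Arr (opcat (deg_index n))"
      then have "u \<in> hom (deg_index n) (Dom (deg_index n) u) (Cod (deg_index n) u)"
        by (simp add: hom_def)
      then show "h (Cod (opcat (deg_index n)) u) \<cdot>\<^bsub>W\<^esub> FArr (deg_diagram X) u =
          h (Dom (opcat (deg_index n)) u)"
      proof (rule hom_deg_indexE)
        fix \<tau> assume u: "u = (Dom (deg_index n) u, \<tau>, Cod (deg_index n) u)"
          and \<tau>: "\<tau> \<in> hom Delta_surj (Cod Delta_surj (Dom (deg_index n) u)) (Cod Delta_surj (Cod (deg_index n) u))"
            "\<tau> \<cdot>\<^bsub>Delta_surj\<^esub> Dom (deg_index n) u = Cod (deg_index n) u"
            "Dom (deg_index n) u \<in> Obj (deg_index n)"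
        have "\<tau> \<in> surjections (Cod Delta_surj (Dom (deg_index n) u))"
          using \<tau>(1) homD(3)[OF \<tau>(1)] by (simp add: surjections_iff)
        moreover have "FArr (deg_diagram X) u = FArr X \<tau>"
          by (subst u) (simp add: deg_diagram_def)
        ultimately show ?thesis using hcomp \<tau>(2,3) by simp
      qed
    qed
    then obtain H where H: "H \<in> hom W L T" "\<And>\<sigma>. \<sigma> \<in> Obj (deg_index n) \<Longrightarrow> H \<cdot>\<^bsub>W\<^esub> i \<sigma> = h \<sigma>"
      using L unfolding is_colimit_def opcat_simps by blast
    show "\<exists>!h. h \<in> hom W L T \<and>
        (\<forall>\<sigma>\<in>Obj (deg_index n). h \<cdot>\<^bsub>W\<^esub> (i \<sigma> \<cdot>\<^bsub>W\<^esub> j (Cod Delta_surj \<sigma>)) = g \<sigma>)"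
    proof (rule ex1I[of _ H], intro conjI ballI)
      fix \<sigma> assume \<sigma>: "\<sigma> \<in> Obj (deg_index n)"
      let ?k = "Cod Delta_surj \<sigma>"
      \<comment> \<open>The identity summand of \<open>h \<sigma>\<close> is where the prescribed
        value \<open>g \<sigma>\<close> is recovered.\<close>
      have id: "Ident Delta_surj ?k \<in> surjections ?k" by (simp add: surjections_eq_insert)
      have "H \<cdot>\<^bsub>W\<^esub> (i \<sigma> \<cdot>\<^bsub>W\<^esub> j ?k) = h \<sigma> \<cdot>\<^bsub>W\<^esub> j ?k"
        using Comp_assoc[OF j[OF lt[OF \<sigma>]] i[OF \<sigma>] H(1)] H(2)[OF \<sigma>] by simp
      also have "\<dots> = h \<sigma> \<cdot>\<^bsub>W\<^esub> (FArr X (Ident Delta_surj ?k) \<cdot>\<^bsub>W\<^esub> j ?k)"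
        using X.FArr_Ident[of ?k] Ident_Comp[OF j[OF lt[OF \<sigma>]]] by simp
      also have "\<dots> = g (Ident Delta_surj ?k \<cdot>\<^bsub>Delta_surj\<^esub> \<sigma>)"
        using hg[OF \<sigma> id] by simp
      also have "\<dots> = g \<sigma>" using Delta_surj.Ident_Comp[OF Obj_deg_index_hom[OF \<sigma>]] by simp
      finally show "H \<cdot>\<^bsub>W\<^esub> (i \<sigma> \<cdot>\<^bsub>W\<^esub> j ?k) = g \<sigma>" .
    next
      fix K assume K': "K \<in> hom W L T \<and>
        (\<forall>\<sigma>\<in>Obj (deg_index n). K \<cdot>\<^bsub>W\<^esub> (i \<sigma> \<cdot>\<^bsub>W\<^esub> j (Cod Delta_surj \<sigma>)) = g \<sigma>)"
      then have K: "K \<in> hom W L T" by blast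
      \<comment> \<open>\<open>K\<close> is constrained only on the identity summands, but the
        cocone relation moves the summand \<open>\<tau>\<close> at \<open>\<sigma>\<close> to the
        identity summand at \<open>\<tau>\<sigma>\<close>.\<close>
      have "K \<cdot>\<^bsub>W\<^esub> i \<sigma> = h \<sigma>" if \<sigma>: "\<sigma> \<in> Obj (deg_index n)" for \<sigma>
      proof (rule is_coproduct_eqI[OF IH[OF lt[OF \<sigma>]] Comp_hom[OF i[OF \<sigma>] K] h[OF \<sigma>]])
        fix \<tau> assume \<tau>: "\<tau> \<in> surjections (Cod Delta_surj \<sigma>)"
        let ?j = "j (Cod Delta_surj \<tau>)"
        note jt = jh[OF \<tau> lt[OF \<sigma>]]
        have "K \<cdot>\<^bsub>W\<^esub> i \<sigma> \<cdot>\<^bsub>W\<^esub> (FArr X \<tau> \<cdot>\<^bsub>W\<^esub> ?j) = K \<cdot>\<^bsub>W\<^esub> (i \<sigma> \<cdot>\<^bsub>W\<^esub> FArr X \<tau> \<cdot>\<^bsub>W\<^esub> ?j)"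
          using Comp_assoc[OF Comp_hom[OF jt Xh[OF \<tau>]] i[OF \<sigma>] K]
            Comp_assoc[OF jt Xh[OF \<tau>] i[OF \<sigma>]] by simp
        also have "\<dots> = g (\<tau> \<cdot>\<^bsub>Delta_surj\<^esub> \<sigma>)"
          using K' cocone[OF \<sigma> \<tau>] comp[OF \<sigma> \<tau>] by metis
        finally show "K \<cdot>\<^bsub>W\<^esub> i \<sigma> \<cdot>\<^bsub>W\<^esub> (FArr X \<tau> \<cdot>\<^bsub>W\<^esub> ?j) = h \<sigma> \<cdot>\<^bsub>W\<^esub> (FArr X \<tau> \<cdot>\<^bsub>W\<^esub> ?j)"
          using hg[OF \<sigma> \<tau>] by simp
      qed
      then show "K = H"
        using H by (intro is_colimit_eqI[OF L J F K H(1)]) simp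
    qed (rule H)
  qed
qed

text \<open>Functoriality makes the maps \<open>FArr X \<sigma>\<close> a cocone with vertex
  \<open>FObj X n\<close>. The colimit property then gives the unique existence that the definite
  description in \<open>deg_map\<close> relies on.\<close>

lemma deg_map_universal:
  assumes W: "category W" and X: "cat_functor (opcat Delta_surj) W X"
    and L: "is_colimit W (opcat (deg_index n)) (deg_diagram X) (deg_obj W X n) (deg_in W X n)"
  shows "deg_map W X n \<in> hom W (deg_obj W X n) (FObj X n)"
    and "\<sigma> \<in> Obj (deg_index n) \<Longrightarrow> deg_map W X n \<cdot>\<^bsub>W\<^esub> deg_in W X n \<sigma> = FArr X \<sigma>"
proof -
  interpret X: cat_functor "opcat Delta_surj" W X by fact
  have "is_cocone W (opcat (deg_index n)) (deg_diagram X) (FObj X n) (FArr X)"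
    unfolding is_cocone_def
  proof (intro conjI ballI)
    show "FObj X n \<in> Obj W" using X.FObj_in by simp
    show "FArr X \<sigma> \<in> hom W (FObj (deg_diagram X) \<sigma>) (FObj X n)"
      if "\<sigma> \<in> Obj (opcat (deg_index n))" for \<sigma>
      using that X.FArr_hom Obj_deg_index_hom by (simp add: deg_diagram_def)
    fix u assume "u \<in> Arr (opcat (deg_index n))"
    then have "u \<in> hom (deg_index n) (Dom (deg_index n) u) (Cod (deg_index n) u)"
      by (simp add: hom_def)
    then obtain \<sigma> \<tau> \<rho> where u: "u = (\<sigma>, \<tau>, \<rho>)"
      and \<tau>: "\<tau> \<in> hom Delta_surj (Cod Delta_surj \<sigma>) (Cod Delta_surj \<rho>)"
        "\<tau> \<cdot>\<^bsub>Delta_surj\<^esub> \<sigma> = \<rho>" "\<sigma> \<in> Obj (deg_index n)"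
      by (metis hom_deg_indexE)
    show "FArr X (Cod (opcat (deg_index n)) u) \<cdot>\<^bsub>W\<^esub> FArr (deg_diagram X) u =
        FArr X (Dom (opcat (deg_index n)) u)"
      using X.FArr_Comp[of \<tau> "Cod Delta_surj \<rho>" "Cod Delta_surj \<sigma>" \<sigma> n] \<tau> Obj_deg_index_hom[OF \<tau>(3)]
      by (simp add: u deg_diagram_def)
  qed
  then have "\<exists>!h. h \<in> hom W (deg_obj W X n) (FObj X n) \<and>
      (\<forall>\<sigma>\<in>Obj (deg_index n). h \<cdot>\<^bsub>W\<^esub> deg_in W X n \<sigma> = FArr X \<sigma>)"
    using L unfolding is_colimit_def opcat_simps by blast
  from theI'[OF this] show "deg_map W X n \<in> hom W (deg_obj W X n) (FObj X n)"
    and "\<sigma> \<in> Obj (deg_index n) \<Longrightarrow> deg_map W X n \<cdot>\<^bsub>W\<^esub> deg_in W X n \<sigma> = FArr X \<sigma>"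
    unfolding deg_map_def by blast+
qed

text \<open>Formulated in an arbitrary category \<open>W\<close>, with just the colimits that occur
  taken as existing; enriched quivers are substituted only at the end.\<close>

theorem nondeg_decomposition:
  assumes W: "category W" and X: "cat_functor (opcat Delta_surj) W X"
    and colim: "\<And>n. \<exists>L i. is_colimit W (opcat (deg_index n)) (deg_diagram X) L i"
    and coprod: "\<And>a b. a \<in> Obj W \<Longrightarrow> b \<in> Obj W \<Longrightarrow> \<exists>P i. is_coproduct W (UNIV :: bool set) (case_bool a b) P i"
    and N: "\<And>k. is_nondeg_part W X k (N k)"
  shows "isomorphic W (FObj X n) (Coprod W (surjections n) (\<lambda>\<sigma>. N (Cod Delta_surj \<sigma>)))"
proof -
  interpret category W by fact
  interpret X: cat_functor "opcat Delta_surj" W X by fact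
  have L: "is_colimit W (opcat (deg_index k)) (deg_diagram X) (deg_obj W X k) (deg_in W X k)" for k
    unfolding deg_obj_def deg_in_def using colim[of k] by (elim exE) (rule is_colimit_chosen)
  note dm = deg_map_universal[OF W X L]
  \<comment> \<open>Produces the inclusion of the non-degenerate part that is complementary to
    \<open>deg_map\<close> itself, in every dimension at once, so that one choice of inclusions
    serves the whole induction.\<close>
  have "\<exists>r \<in> hom W (N k) (FObj X k).
      is_coproduct W UNIV (case_bool (deg_obj W X k) (N k)) (FObj X k) (case_bool (deg_map W X k) r)" for k
  proof -
    let ?P = "Coprod W UNIV (case_bool (deg_obj W X k) (N k))"
    let ?i = "coproj W UNIV (case_bool (deg_obj W X k) (N k))"
    have "N k \<in> Obj W" using N by (simp add: is_nondeg_part_def)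
    then have P: "is_coproduct W UNIV (case_bool (deg_obj W X k) (N k)) ?P ?i"
      using coprod[OF is_colimitD(1)[OF L]] by (blast intro: is_coproduct_Coprod)
    have l: "?i True \<in> hom W (deg_obj W X k) ?P"
      using is_coproductD(2)[OF P, of True] by simp
    obtain u v where uv: "u \<in> hom W (deg_obj W X k) (deg_obj W X k)" "v \<in> hom W (FObj X k) ?P"
      "is_iso W u" "is_iso W v" "v \<cdot>\<^bsub>W\<^esub> deg_map W X k = ?i True \<cdot>\<^bsub>W\<^esub> u"
      using N[of k] unfolding is_nondeg_part_def isomorphic_arrows_def left_coproj_def
        homD(2,3)[OF l] homD(2,3)[OF dm(1)[of k]] by blast
    show ?thesis
      using is_coproduct_pull_iso[OF P dm(1) uv(1,3,2,4,5)] .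
  qed
  then obtain j where j: "\<And>k. j k \<in> hom W (N k) (FObj X k)"
    and X_coprod: "\<And>k. is_coproduct W UNIV (case_bool (deg_obj W X k) (N k)) (FObj X k)
      (case_bool (deg_map W X k) (j k))"
    by metis
  have main: "is_coproduct W (surjections n) (\<lambda>\<sigma>. N (Cod Delta_surj \<sigma>)) (FObj X n)
      (\<lambda>\<sigma>. FArr X \<sigma> \<cdot>\<^bsub>W\<^esub> j (Cod Delta_surj \<sigma>))" for n
  proof (induction n rule: less_induct)
    case (less n)
    let ?id = "Ident Delta_surj n"
    let ?c = "\<lambda>\<sigma>. if \<sigma> = ?id then j n
      else deg_map W X n \<cdot>\<^bsub>W\<^esub> (deg_in W X n \<sigma> \<cdot>\<^bsub>W\<^esub> j (Cod Delta_surj \<sigma>))"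
    have "is_coproduct W (Obj (deg_index n)) (\<lambda>\<sigma>. N (Cod Delta_surj \<sigma>)) (deg_obj W X n)
        (\<lambda>\<sigma>. deg_in W X n \<sigma> \<cdot>\<^bsub>W\<^esub> j (Cod Delta_surj \<sigma>))"
      using less j by (intro is_coproduct_deg[OF W X L])
    then have *: "is_coproduct W (surjections n) (\<lambda>\<sigma>. N (Cod Delta_surj \<sigma>)) (FObj X n) ?c"
      unfolding surjections_eq_insert
      by (rule is_coproduct_insert) (use j X_coprod dm(1) in \<open>simp_all add: Obj_deg_index\<close>)
    \<comment> \<open>The legs obtained by adjoining the identity summand have the uniform formula:
      at the identity because \<open>X\<close> preserves identities, elsewhere because
      \<open>deg_map\<close> composed with a colimit leg is \<open>X(\<sigma>)\<close>.\<close>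
    have "?c \<sigma> = FArr X \<sigma> \<cdot>\<^bsub>W\<^esub> j (Cod Delta_surj \<sigma>)" if \<sigma>: "\<sigma> \<in> surjections n" for \<sigma>
    proof (cases "\<sigma> = ?id")
      case True
      then show ?thesis using X.FArr_Ident[of n] Ident_Comp[OF j] by simp
    next
      case False
      then have \<sigma>': "\<sigma> \<in> Obj (deg_index n)" using \<sigma> by (simp add: surjections_eq_insert)
      have d: "deg_in W X n \<sigma> \<in> hom W (FObj X (Cod Delta_surj \<sigma>)) (deg_obj W X n)"
        using is_colimitD(2)[OF L[of n], of \<sigma>] \<sigma>' by (simp add: deg_diagram_def)
      then show ?thesis
        using False Comp_assoc[OF j d dm(1)] dm(2)[OF \<sigma>'] by simp
    qed
    then show ?case using * by (simp add: is_coproduct_def)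
  qed
  \<comment> \<open>The coproduct just constructed also serves as the witness that the chosen
    \<open>Coprod\<close> is a coproduct of the same family.\<close>
  show ?thesis
    using is_coproduct_isomorphic[OF main is_coproduct_Coprod[OF main]] .
qed

section \<open>Finite colimits of quivers\<close>

definition relabel_cat :: "('j \<Rightarrow> 'o) \<Rightarrow> ('k \<Rightarrow> 'a) \<Rightarrow> ('j, 'k, 'x) cat_scheme \<Rightarrow> ('o, 'a) cat" where
  "relabel_cat f g J =
    \<lparr>Obj = f ` Obj J, Arr = g ` Arr J,
     Dom = (\<lambda>u. f (Dom J (inv_into (Arr J) g u))), Cod = (\<lambda>u. f (Cod J (inv_into (Arr J) g u))),
     Ident = (\<lambda>a. g (Ident J (inv_into (Obj J) f a))),
     Comp = (\<lambda>v u. g (Comp J (inv_into (Arr J) g v) (inv_into (Arr J) g u)))\<rparr>"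

text \<open>\<open>cocomplete_cat\<close> speaks only of categories whose objects and arrows both
  live in one type. Separate injections on objects and on arrows transport a category of any types
  there.\<close>

locale relabelling = category J
  for J :: "('j, 'k, 'x) cat_scheme" (structure)
    and f :: "'j \<Rightarrow> 'o" and g :: "'k \<Rightarrow> 'a" +
  assumes inj: "inj_on f (Obj J)" "inj_on g (Arr J)"
begin

lemma relabel_simps [simp]:
  "Obj (relabel_cat f g J) = f ` Obj J" "Arr (relabel_cat f g J) = g ` Arr J"
  "u \<in> Arr J \<Longrightarrow> Dom (relabel_cat f g J) (g u) = f (Dom J u)"
  "u \<in> Arr J \<Longrightarrow> Cod (relabel_cat f g J) (g u) = f (Cod J u)"
  "a \<in> Obj J \<Longrightarrow> Ident (relabel_cat f g J) (f a) = g (Ident J a)"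
  "u \<in> Arr J \<Longrightarrow> v \<in> Arr J \<Longrightarrow> g v \<cdot>\<^bsub>relabel_cat f g J\<^esub> g u = g (v \<cdot> u)"
  using inj by (simp_all add: relabel_cat_def)

lemma hom_relabelE:
  assumes "u \<in> hom (relabel_cat f g J) a b"
  obtains u' a' b' where "u = g u'" "u' \<in> hom J a' b'" "a = f a'" "b = f b'" "a' \<in> Obj J" "b' \<in> Obj J"
proof -
  obtain u' where u': "u' \<in> Arr J" "u = g u'" using assms by (auto simp: hom_def)
  show thesis
    by (rule that[of u' "Dom J u'" "Cod J u'"])
      (use u' assms Dom_in Cod_in in \<open>auto simp: hom_def\<close>)
qed

lemma hom_relabel:
  assumes "u \<in> hom J a b"
  shows "g u \<in> hom (relabel_cat f g J) (f a) (f b)"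
  using assms by (auto simp: hom_def)

text \<open>Injectivity on objects allows the source of the preimage to be prescribed, so composable
  arrows of the copy lift to composable arrows of \<open>J\<close>.\<close>

lemma hom_relabel_fromE:
  assumes "u \<in> hom (relabel_cat f g J) (f a) b" "a \<in> Obj J"
  obtains u' b' where "u = g u'" "u' \<in> hom J a b'" "b = f b'" "b' \<in> Obj J"
  using assms inj_onD[OF inj(1)] by (metis hom_relabelE)

lemma comp_relabel:
  "u \<in> hom J a b \<Longrightarrow> v \<in> hom J b c \<Longrightarrow> g v \<cdot>\<^bsub>relabel_cat f g J\<^esub> g u = g (v \<cdot> u)"
  by (simp add: homD(1))

lemma category_relabel: "category (relabel_cat f g J)"
proof
  fix u assume "u \<in> Arr (relabel_cat f g J)"
  then show "Dom (relabel_cat f g J) u \<in> Obj (relabel_cat f g J)"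
    "Cod (relabel_cat f g J) u \<in> Obj (relabel_cat f g J)"
    using Dom_in Cod_in by auto
next
  fix a assume "a \<in> Obj (relabel_cat f g J)"
  then show "Ident (relabel_cat f g J) a \<in> hom (relabel_cat f g J) a a"
    using hom_relabel Ident_hom by auto
next
  fix a b c u v assume u: "u \<in> hom (relabel_cat f g J) a b" and v: "v \<in> hom (relabel_cat f g J) b c"
  obtain u' a' b' where u': "u = g u'" "u' \<in> hom J a' b'" "a = f a'" "b = f b'" "b' \<in> Obj J"
    using hom_relabelE[OF u] .
  obtain v' c' where v': "v = g v'" "v' \<in> hom J b' c'" "c = f c'"
    using hom_relabel_fromE[OF v[unfolded u'(4)] u'(5)] .
  show "v \<cdot>\<^bsub>relabel_cat f g J\<^esub> u \<in> hom (relabel_cat f g J) a c"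
    unfolding u'(1,3) v'(1,3) comp_relabel[OF u'(2) v'(2)]
    using u'(2) v'(2) by (intro hom_relabel Comp_hom)
next
  fix a b u assume "u \<in> hom (relabel_cat f g J) a b"
  then show "u \<cdot>\<^bsub>relabel_cat f g J\<^esub> Ident (relabel_cat f g J) a = u"
    "Ident (relabel_cat f g J) b \<cdot>\<^bsub>relabel_cat f g J\<^esub> u = u"
    by (auto elim!: hom_relabelE simp: homD(1) homD(1)[OF Ident_hom] Comp_Ident Ident_Comp)
next
  fix a b c d u v w
  assume u: "u \<in> hom (relabel_cat f g J) a b" and v: "v \<in> hom (relabel_cat f g J) b c"
    and w: "w \<in> hom (relabel_cat f g J) c d"
  obtain u' a' b' where u': "u = g u'" "u' \<in> hom J a' b'" "b = f b'" "b' \<in> Obj J"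
    using hom_relabelE[OF u] .
  obtain v' c' where v': "v = g v'" "v' \<in> hom J b' c'" "c = f c'" "c' \<in> Obj J"
    using hom_relabel_fromE[OF v[unfolded u'(3)] u'(4)] .
  obtain w' d' where w': "w = g w'" "w' \<in> hom J c' d'"
    using hom_relabel_fromE[OF w[unfolded v'(3)] v'(4)] .
  show "w \<cdot>\<^bsub>relabel_cat f g J\<^esub> v \<cdot>\<^bsub>relabel_cat f g J\<^esub> u =
      w \<cdot>\<^bsub>relabel_cat f g J\<^esub> (v \<cdot>\<^bsub>relabel_cat f g J\<^esub> u)"
    using comp_relabel[OF u'(2) v'(2)] comp_relabel[OF v'(2) w'(2)] Comp_assoc[OF u'(2) v'(2) w'(2)]
      comp_relabel[OF Comp_hom[OF u'(2) v'(2)] w'(2)] comp_relabel[OF u'(2) Comp_hom[OF v'(2) w'(2)]]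
    by (simp add: u'(1) v'(1) w'(1))
qed

end

lemma is_cocone_cong:
  assumes "category J" "\<And>x. x \<in> Obj J \<Longrightarrow> g x = g' x"
  shows "is_cocone C J F T g \<longleftrightarrow> is_cocone C J F T g'"
  using assms category.Dom_in[OF assms(1)] category.Cod_in[OF assms(1)]
  unfolding is_cocone_def by auto

lemma finite_colimit_exists:
  fixes C :: "('o, 'a, 'x) cat_scheme" and J :: "('j, 'k, 'y) cat_scheme"
    and F :: "('j, 'k, 'o, 'a) functor_data"
  assumes inf: "infinite (UNIV :: 'i set)" and coc: "cocomplete_cat TYPE('i) C"
    and J: "category J" and fin: "finite (Obj J)" "finite (Arr J)" and F: "cat_functor J C F"
  shows "\<exists>L i. is_colimit C J F L i"
proof -
  \<comment> \<open>An infinite type contains finite subsets of every size, hence a copy of any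
    finite set.\<close>
  obtain f :: "'j \<Rightarrow> 'i" where f: "inj_on f (Obj J)"
    using fin(1) by (metis card_le_inj infinite_arbitrarily_large[OF inf] order_refl)
  obtain g :: "'k \<Rightarrow> 'i" where g: "inj_on g (Arr J)"
    using fin(2) by (metis card_le_inj infinite_arbitrarily_large[OF inf] order_refl)
  interpret relabelling J f g
    using J f g by (simp add: relabelling_def relabelling_axioms_def)
  interpret F: cat_functor J C F by fact
  let ?f' = "inv_into (Obj J) f" and ?g' = "inv_into (Arr J) g"
  let ?J = "relabel_cat f g J"
  define F' where "F' = \<lparr>FObj = (\<lambda>x. FObj F (?f' x)), FArr = (\<lambda>u. FArr F (?g' u))\<rparr>"
  have F'_simps [simp]: "x \<in> Obj J \<Longrightarrow> FObj F' (f x) = FObj F x"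
    "u \<in> Arr J \<Longrightarrow> FArr F' (g u) = FArr F u" for x u
    using inj by (simp_all add: F'_def)
  have "cat_functor ?J C F'"
  proof
    fix a b c u v assume u: "u \<in> hom ?J a b" and v: "v \<in> hom ?J b c"
    obtain u' a' b' where u': "u = g u'" "u' \<in> hom J a' b'" "b = f b'" "b' \<in> Obj J"
      using hom_relabelE[OF u] .
    obtain v' c' where v': "v = g v'" "v' \<in> hom J b' c'"
      using hom_relabel_fromE[OF v[unfolded u'(3)] u'(4)] .
    show "FArr F' (v \<cdot>\<^bsub>?J\<^esub> u) = FArr F' v \<cdot>\<^bsub>C\<^esub> FArr F' u"
      using u'(2) v'(2) homD(1)[OF Comp_hom[OF u'(2) v'(2)]] F.FArr_Comp[OF u'(2) v'(2)]
      by (simp add: u'(1) v'(1) homD(1))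
  next
    fix a b u assume "u \<in> hom ?J a b"
    then show "FArr F' u \<in> hom C (FObj F' a) (FObj F' b)"
      by (elim hom_relabelE) (auto simp: homD(1) F.FArr_hom)
  next
    fix a assume "a \<in> Obj ?J"
    then show "FObj F' a \<in> Obj C" "FArr F' (Ident ?J a) = Ident C (FObj F' a)"
      by (auto simp: F.FObj_in F.FArr_Ident homD(1)[OF Ident_hom])
  qed
  then obtain L i where L: "is_colimit C ?J F' L i"
    using coc category_relabel unfolding cocomplete_cat_def by blast
  \<comment> \<open>Relabelling does not change arrows of \<open>C\<close>, so cocones on the copy
    are cocones on \<open>F\<close> with legs reindexed along \<open>f\<close>.\<close>
  have cocone: "is_cocone C ?J F' T h \<longleftrightarrow> is_cocone C J F T (\<lambda>x. h (f x))" for T h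
    by (auto simp: is_cocone_def)
  have "is_colimit C J F L (\<lambda>x. i (f x))"
    unfolding is_colimit_def
  proof (intro conjI allI impI)
    show "is_cocone C J F L (\<lambda>x. i (f x))"
      using L cocone unfolding is_colimit_def by blast
    fix T h assume "is_cocone C J F T h"
    \<comment> \<open>Writing the legs as a function of \<open>f x\<close> brings them into the form
      required by the correspondence of cocones; on objects of \<open>J\<close> the inverse cancels
      \<open>f\<close>.\<close>
    then have "is_cocone C J F T (\<lambda>x. h (?f' (f x)))"
      using is_cocone_cong[OF J, of "\<lambda>x. h (?f' (f x))" h C F T] inj by simp
    then have "is_cocone C ?J F' T (\<lambda>x. h (?f' x))" using cocone by simp
    then have "\<exists>!k. k \<in> hom C L T \<and> (\<forall>x\<in>Obj ?J. k \<cdot>\<^bsub>C\<^esub> i x = h (?f' x))"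
      using L unfolding is_colimit_def by blast
    then show "\<exists>!k. k \<in> hom C L T \<and> (\<forall>x\<in>Obj J. k \<cdot>\<^bsub>C\<^esub> i (f x) = h x)"
      using inj by simp
  qed
  then show ?thesis by blast
qed

section \<open>The category of quivers and its finite colimits\<close>

lemma Quiv_simps [simp]:
  "Obj (Quiv V S) = S \<times> S \<rightarrow>\<^sub>E Obj V"
  "Arr (Quiv V S) = S \<times> S \<rightarrow>\<^sub>E Arr V"
  "Dom (Quiv V S) f = (\<lambda>p \<in> S \<times> S. Dom V (f p))"
  "Cod (Quiv V S) f = (\<lambda>p \<in> S \<times> S. Cod V (f p))"
  "Ident (Quiv V S) Q = (\<lambda>p \<in> S \<times> S. Ident V (Q p))"
  "g \<cdot>\<^bsub>Quiv V S\<^esub> f = (\<lambda>p \<in> S \<times> S. g p \<cdot>\<^bsub>V\<^esub> f p)"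
  by (simp_all add: Quiv_def quiv_cat_def cat.defs)

text \<open>Source and target of a quiver morphism are restricted functions. They can be compared
  with \<open>Q\<close> and \<open>P\<close> pointwise because these are extensional as
  well.\<close>

lemma hom_Quiv:
  assumes "Q \<in> Obj (Quiv V S)" "P \<in> Obj (Quiv V S)"
  shows "f \<in> hom (Quiv V S) Q P \<longleftrightarrow>
    f \<in> extensional (S \<times> S) \<and> (\<forall>p \<in> S \<times> S. f p \<in> hom V (Q p) (P p))"
  using assms by (auto simp: hom_def PiE_iff extensional_def fun_eq_iff restrict_def)

lemma hom_Quiv_component:
  assumes "f \<in> hom (Quiv V S) Q P" "p \<in> S \<times> S"
  shows "f p \<in> hom V (Q p) (P p)"
  using assms by (auto simp: hom_def PiE_iff)

lemma hom_Quiv_extensional: "f \<in> hom (Quiv V S) Q P \<Longrightarrow> f \<in> extensional (S \<times> S)"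
  by (auto simp: hom_def PiE_iff)

lemma category_Quiv:
  assumes "category V"
  shows "category (Quiv V S)"
proof -
  interpret category V by fact
  have Arr_Quiv: "Dom (Quiv V S) f \<in> Obj (Quiv V S)" "Cod (Quiv V S) f \<in> Obj (Quiv V S)"
    if "f \<in> Arr (Quiv V S)" for f
    using that Dom_in Cod_in by (auto simp: PiE_iff)
  then have hom_Obj_Quiv: "Q \<in> Obj (Quiv V S)" "P \<in> Obj (Quiv V S)"
    if "f \<in> hom (Quiv V S) Q P" for f Q P
    using that unfolding hom_def by blast+
  show ?thesis
  proof
    fix f assume "f \<in> Arr (Quiv V S)"
    then show "Dom (Quiv V S) f \<in> Obj (Quiv V S)" "Cod (Quiv V S) f \<in> Obj (Quiv V S)"
      by (fact Arr_Quiv)+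
  next
    fix Q assume "Q \<in> Obj (Quiv V S)"
    then show "Ident (Quiv V S) Q \<in> hom (Quiv V S) Q Q"
      using Ident_hom by (simp add: hom_Quiv[OF \<open>Q \<in> _\<close> \<open>Q \<in> _\<close>]) (auto simp: PiE_iff)
  next
    fix Q P R f g assume f: "f \<in> hom (Quiv V S) Q P" and g: "g \<in> hom (Quiv V S) P R"
    have "(g \<cdot>\<^bsub>Quiv V S\<^esub> f) p \<in> hom V (Q p) (R p)" if "p \<in> S \<times> S" for p
      using Comp_hom[OF hom_Quiv_component[OF f that] hom_Quiv_component[OF g that]] that by simp
    moreover have "g \<cdot>\<^bsub>Quiv V S\<^esub> f \<in> extensional (S \<times> S)" by simp
    ultimately show "g \<cdot>\<^bsub>Quiv V S\<^esub> f \<in> hom (Quiv V S) Q R"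
      unfolding hom_Quiv[OF hom_Obj_Quiv(1)[OF f] hom_Obj_Quiv(2)[OF g]] by blast
  next
    fix Q P f assume f: "f \<in> hom (Quiv V S) Q P"
    show "f \<cdot>\<^bsub>Quiv V S\<^esub> Ident (Quiv V S) Q = f" "Ident (Quiv V S) P \<cdot>\<^bsub>Quiv V S\<^esub> f = f"
      by (rule extensionalityI[of _ "S \<times> S"];
          simp add: hom_Quiv_extensional[OF f] Comp_Ident[OF hom_Quiv_component[OF f]]
            Ident_Comp[OF hom_Quiv_component[OF f]])+
  next
    fix Q P R T f g h
    assume f: "f \<in> hom (Quiv V S) Q P" and g: "g \<in> hom (Quiv V S) P R" and h: "h \<in> hom (Quiv V S) R T"
    show "h \<cdot>\<^bsub>Quiv V S\<^esub> g \<cdot>\<^bsub>Quiv V S\<^esub> f = h \<cdot>\<^bsub>Quiv V S\<^esub> (g \<cdot>\<^bsub>Quiv V S\<^esub> f)"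
      by (rule extensionalityI[of _ "S \<times> S"])
        (use Comp_assoc[OF hom_Quiv_component[OF f] hom_Quiv_component[OF g] hom_Quiv_component[OF h]]
          in simp_all)
  qed
qed

text \<open>Colimits of quivers are computed componentwise: morphisms are families indexed by
  \<open>S \<times> S\<close>, and composition acts on each component separately.\<close>

lemma Quiv_finite_colimit_exists:
  fixes V :: "('o, 'a, 'x) monoidal_cat_scheme" and J :: "('j, 'k, 'y) cat_scheme"
    and S :: "'s set" and F :: "('j, 'k, 's \<times> 's \<Rightarrow> 'o, 's \<times> 's \<Rightarrow> 'a) functor_data"
  assumes inf: "infinite (UNIV :: 'i set)" and V: "category V" and coc: "cocomplete_cat TYPE('i) V"
    and J: "category J" and fin: "finite (Obj J)" "finite (Arr J)"
    and F: "cat_functor J (Quiv V S) F"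
  shows "\<exists>L i. is_colimit (Quiv V S) J F L i"
proof -
  interpret J: category J by fact
  interpret F: cat_functor J "Quiv V S" F by fact
  \<comment> \<open>\<open>G p\<close> is the diagram in \<open>V\<close> obtained by evaluating at
    the pair \<open>p\<close>.\<close>
  define G where "G p = \<lparr>FObj = (\<lambda>x. FObj F x p), FArr = (\<lambda>u. FArr F u p)\<rparr>" for p
  have "\<exists>L i. is_colimit V J (G p) L i" if p: "p \<in> S \<times> S" for p
  proof (rule finite_colimit_exists[OF inf coc J fin], unfold_locales)
    fix a b c u v assume "u \<in> hom J a b" "v \<in> hom J b c"
    then show "FArr (G p) (v \<cdot>\<^bsub>J\<^esub> u) = FArr (G p) v \<cdot>\<^bsub>V\<^esub> FArr (G p) u"
      using F.FArr_Comp p by (simp add: G_def)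
  next
    fix a b u assume "u \<in> hom J a b"
    then show "FArr (G p) u \<in> hom V (FObj (G p) a) (FObj (G p) b)"
      using hom_Quiv_component[OF F.FArr_hom p] by (simp add: G_def)
  next
    fix a assume "a \<in> Obj J"
    then show "FObj (G p) a \<in> Obj V" "FArr (G p) (Ident J a) = Ident V (FObj (G p) a)"
      using F.FObj_in[of a] F.FArr_Ident[of a] p by (auto simp: G_def)
  qed
  then obtain L i where Li: "\<And>p. p \<in> S \<times> S \<Longrightarrow> is_colimit V J (G p) (L p) (i p)"
    by metis
  note LD = is_colimitD[OF Li]
  \<comment> \<open>The restrictions make the componentwise colimit and its legs extensional, as
    objects and arrows of the quiver category must be.\<close>
  let ?L = "\<lambda>p\<in>S \<times> S. L p" and ?i = "\<lambda>x. \<lambda>p\<in>S \<times> S. i p x"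
  have L: "?L \<in> Obj (Quiv V S)" using LD(1) by auto
  have "is_colimit (Quiv V S) J F ?L ?i"
    unfolding is_colimit_def
  proof (intro conjI allI impI)
    show "is_cocone (Quiv V S) J F ?L ?i"
      unfolding is_cocone_def
    proof (intro conjI ballI)
      show "?L \<in> Obj (Quiv V S)" by fact
      show "?i x \<in> hom (Quiv V S) (FObj F x) ?L" if "x \<in> Obj J" for x
        using LD(2) that by (simp add: hom_Quiv[OF F.FObj_in[OF that] L] G_def)
      show "?i (Cod J u) \<cdot>\<^bsub>Quiv V S\<^esub> FArr F u = ?i (Dom J u)" if "u \<in> Arr J" for u
        using LD(3) that by (auto simp: G_def fun_eq_iff)
    qed
    fix T g assume g: "is_cocone (Quiv V S) J F T g"
    then have T: "T \<in> Obj (Quiv V S)"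
      and gh: "\<And>x. x \<in> Obj J \<Longrightarrow> g x \<in> hom (Quiv V S) (FObj F x) T"
      and gu: "\<And>u. u \<in> Arr J \<Longrightarrow> g (Cod J u) \<cdot>\<^bsub>Quiv V S\<^esub> FArr F u = g (Dom J u)"
      by (auto simp: is_cocone_def simp del: Quiv_simps)
    have "\<exists>!h. h \<in> hom V (L p) (T p) \<and> (\<forall>x\<in>Obj J. h \<cdot>\<^bsub>V\<^esub> i p x = g x p)" if p: "p \<in> S \<times> S" for p
    proof -
      have "is_cocone V J (G p) (T p) (\<lambda>x. g x p)"
        unfolding is_cocone_def
      proof (intro conjI ballI)
        show "T p \<in> Obj V" using T p by auto
        show "g x p \<in> hom V (FObj (G p) x) (T p)" if "x \<in> Obj J" for x
          using hom_Quiv_component[OF gh[OF that] p] by (simp add: G_def)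
        show "g (Cod J u) p \<cdot>\<^bsub>V\<^esub> FArr (G p) u = g (Dom J u) p" if "u \<in> Arr J" for u
          using fun_cong[OF gu[OF that], of p] p by (simp add: G_def)
      qed
      then show ?thesis using Li[OF p] unfolding is_colimit_def by blast
    qed
    then obtain h where h: "\<And>p. p \<in> S \<times> S \<Longrightarrow> h p \<in> hom V (L p) (T p)"
      "\<And>p x. p \<in> S \<times> S \<Longrightarrow> x \<in> Obj J \<Longrightarrow> h p \<cdot>\<^bsub>V\<^esub> i p x = g x p"
      and uniq: "\<And>p k. p \<in> S \<times> S \<Longrightarrow> k \<in> hom V (L p) (T p) \<Longrightarrow>
        (\<And>x. x \<in> Obj J \<Longrightarrow> k \<cdot>\<^bsub>V\<^esub> i p x = g x p) \<Longrightarrow> k = h p"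
      by metis
    show "\<exists>!h. h \<in> hom (Quiv V S) ?L T \<and> (\<forall>x\<in>Obj J. h \<cdot>\<^bsub>Quiv V S\<^esub> ?i x = g x)"
    proof (rule ex1I[of _ "restrict h (S \<times> S)"], intro conjI ballI)
      show "restrict h (S \<times> S) \<in> hom (Quiv V S) ?L T"
        using h(1) by (simp add: hom_Quiv[OF L T])
      show "restrict h (S \<times> S) \<cdot>\<^bsub>Quiv V S\<^esub> ?i x = g x" if "x \<in> Obj J" for x
        by (rule extensionalityI[of _ "S \<times> S"])
          (use h(2) that hom_Quiv_extensional[OF gh[OF that]] in simp_all)
      fix k assume k: "k \<in> hom (Quiv V S) ?L T \<and> (\<forall>x\<in>Obj J. k \<cdot>\<^bsub>Quiv V S\<^esub> ?i x = g x)"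
      show "k = restrict h (S \<times> S)"
      \<comment> \<open>Inside \<open>S \<times> S\<close> uniqueness is inherited from the
        componentwise colimits; outside, both functions are undefined.\<close>
      proof (rule extensionalityI[of _ "S \<times> S"])
        fix p assume p: "p \<in> S \<times> S"
        have "k p = h p"
        proof (rule uniq[OF p])
          show "k p \<in> hom V (L p) (T p)" using hom_Quiv_component[of k V S ?L T p] k p by simp
          show "k p \<cdot>\<^bsub>V\<^esub> i p x = g x p" if "x \<in> Obj J" for x
          proof -
            have "(k \<cdot>\<^bsub>Quiv V S\<^esub> ?i x) p = g x p" using k that by metis
            then show ?thesis using p by simp
          qed
        qed
        then show "k p = restrict h (S \<times> S) p" using p by simp
      qed (use k hom_Quiv_extensional in auto)
    qed
  qed
  then show ?thesis by blast
qed

section \<open>Coproducts as colimits of discrete diagrams\<close>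

definition discrete_cat :: "'j set \<Rightarrow> ('j, 'j) cat" where
  "discrete_cat A = \<lparr>Obj = A, Arr = A, Dom = id, Cod = id, Ident = id, Comp = (\<lambda>v u. u)\<rparr>"

lemma hom_discrete_cat: "u \<in> hom (discrete_cat A) a b \<longleftrightarrow> u \<in> A \<and> a = u \<and> b = u"
  by (auto simp: discrete_cat_def hom_def)

lemma category_discrete_cat: "category (discrete_cat A)"
  by unfold_locales (auto simp: hom_discrete_cat, auto simp: discrete_cat_def)

text \<open>The only transition maps are identities, so the cocone condition is the right unit law
  and any family of arrows to \<open>T\<close> is a cocone.\<close>

lemma is_coproduct_if_discrete_colimit:
  assumes "category C"
    and "is_colimit C (discrete_cat A) \<lparr>FObj = F, FArr = (\<lambda>x. Ident C (F x))\<rparr> P i"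
  shows "is_coproduct C A F P i"
proof -
  have "is_cocone C (discrete_cat A) \<lparr>FObj = F, FArr = (\<lambda>x. Ident C (F x))\<rparr> T g \<longleftrightarrow>
      T \<in> Obj C \<and> (\<forall>x\<in>A. g x \<in> hom C (F x) T)" for T g
    using category.Comp_Ident[OF assms(1)] by (auto simp: is_cocone_def discrete_cat_def)
  then show ?thesis
    using assms(2) by (simp add: is_colimit_def is_coproduct_def) (simp add: discrete_cat_def)
qed

lemma Quiv_finite_coproduct_exists:
  fixes V :: "('o, 'a, 'x) monoidal_cat_scheme"
  assumes inf: "infinite (UNIV :: 'i set)" and V: "category V" and coc: "cocomplete_cat TYPE('i) V"
    and fin: "finite A" and Q: "\<And>x. x \<in> A \<Longrightarrow> Q x \<in> Obj (Quiv V S)"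
  shows "\<exists>P i. is_coproduct (Quiv V S) A Q P i"
proof -
  interpret category "Quiv V S" using V by (rule category_Quiv)
  let ?F = "\<lparr>FObj = Q, FArr = (\<lambda>x. Ident (Quiv V S) (Q x))\<rparr>"
  have F: "cat_functor (discrete_cat A) (Quiv V S) ?F"
    using Q Ident_hom Comp_Ident[OF Ident_hom]
    by unfold_locales (auto simp: hom_discrete_cat simp del: Quiv_simps, auto simp: discrete_cat_def simp del: Quiv_simps)
  have "finite (Obj (discrete_cat A))" "finite (Arr (discrete_cat A))"
    using fin by (simp_all add: discrete_cat_def)
  from Quiv_finite_colimit_exists[OF inf V coc category_discrete_cat this F]
  obtain L i where "is_colimit (Quiv V S) (discrete_cat A) ?F L i" by blast
  then show ?thesis
    using is_coproduct_if_discrete_colimit[OF category_axioms] by blast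
qed

section \<open>Restriction to surjections and the conclusion\<close>

lemma cat_functor_restrict_Delta_surj:
  assumes "cat_functor (op_monoidal Delta_f) W X"
  shows "cat_functor (opcat Delta_surj) W X"
proof -
  interpret X: cat_functor "op_monoidal Delta_f" W X by fact
  \<comment> \<open>\<open>Delta_surj\<close> differs from \<open>Delta_f\<close> only in its set of
    arrows, and \<open>op_monoidal\<close> alters only coherence maps beyond reversing arrows. Hence
    the same data restrict.\<close>
  have hom: "u \<in> hom Delta_surj b a \<Longrightarrow> u \<in> hom (op_monoidal Delta_f) a b" for u a b
    by (auto simp: hom_def op_monoidal_def opcat_def Delta_surj_def)
  have eqs: "Obj (op_monoidal Delta_f) = UNIV" "Ident (op_monoidal Delta_f) = Ident Delta_surj"
    "Comp (op_monoidal Delta_f) = (\<lambda>g f. Comp Delta_surj f g)"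
    by (simp_all add: op_monoidal_def opcat_def Delta_surj_def Delta_f_def)
  show ?thesis
  proof
    fix a b c u v
    assume "u \<in> hom (opcat Delta_surj) a b" "v \<in> hom (opcat Delta_surj) b c"
    then have "u \<in> hom (op_monoidal Delta_f) a b" "v \<in> hom (op_monoidal Delta_f) b c"
      using hom by simp_all
    from X.FArr_Comp[OF this]
    show "FArr X (v \<cdot>\<^bsub>opcat Delta_surj\<^esub> u) = FArr X v \<cdot>\<^bsub>W\<^esub> FArr X u"
      unfolding eqs by simp
  qed (use X.FObj_in X.FArr_hom X.FArr_Ident hom in \<open>simp_all add: eqs del: Delta_surj_simps(4,5)\<close>)
qed

theorem lemma2p19:
  fixes V :: "('o, 'a, 'x) symmetric_monoidal_cat_scheme"
    and S :: "'i set"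
    and X :: "('i, 'o, 'a) templicial"
    and Xnd :: "nat \<Rightarrow> 'i \<times> 'i \<Rightarrow> 'o"
    and n :: nat
  assumes "infinite (UNIV :: 'i set)"
    and "symmetric_monoidal_closed_category V"
    and "complete_cat TYPE('i) V"
    and "cocomplete_cat TYPE('i) V"
    and "templicial_object V X S"
    and "has_nondeg_simplices V X S"
    and "\<And>k. is_nondeg_part (Quiv V S) X k (Xnd k)"
  shows "isomorphic (Quiv V S) (FObj X n)
    (Coprod (Quiv V S) (surjections n) (\<lambda>\<sigma>. Xnd (Cod Delta_surj \<sigma>)))"
proof (rule nondeg_decomposition)
  have V: "category V"
    using assms(2) by (simp add: symmetric_monoidal_closed_category_def
        symmetric_monoidal_category_def monoidal_category_def)
  show "category (Quiv V S)" using V by (rule category_Quiv)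
  show X: "cat_functor (opcat Delta_surj) (Quiv V S) X"
    using assms(5) by (intro cat_functor_restrict_Delta_surj)
      (simp add: templicial_object_def colax_monoidal_functor_def)
  \<comment> \<open>Finiteness of the index category of proper surjections brings this within reach
    of cocompleteness relative to the infinite type \<open>'i\<close>.\<close>
  show "\<exists>L i. is_colimit (Quiv V S) (opcat (deg_index n)) (deg_diagram X) L i" for n
    by (rule Quiv_finite_colimit_exists[OF assms(1) V assms(4)
          category_opcat[OF category_deg_index] _ _ cat_functor_deg_diagram[OF X]])
      (simp_all add: finite_deg_index)
  show "\<exists>P i. is_coproduct (Quiv V S) (UNIV :: bool set) (case_bool a b) P i"
    if "a \<in> Obj (Quiv V S)" "b \<in> Obj (Quiv V S)" for a b
    by (rule Quiv_finite_coproduct_exists[OF assms(1) V assms(4)])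
      (use that in \<open>auto split: bool.splits\<close>)
  show "is_nondeg_part (Quiv V S) X k (Xnd k)" for k by (rule assms)
qed

end
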